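(* Over $\mathrm{RCA}_0$, the following statement (the Restricted Valuation Extension Lemma for $\mathbf{CTL}$) implies $\Pi^1_1$-$\mathrm{CA}_0$: for each serial frame $F=(W,R)$, each $n\in\mathbb{N}$ and each $v:W\times\mathrm{Prop}\to\{0,1\}$, there exists an $n$-restricted $\mathbf{CTL}$-valuation $V$ on $(W,R)$ such that $V$ is an extension of $v$.
   Context: Setting: second-order arithmetic. $\mathrm{RCA}_0$ consists of Robinson arithmetic, $\Sigma^0_1$-induction and $\Delta^0_1$-comprehension; $\Pi^1_1$-$\mathrm{CA}_0$ adds comprehension for all $\Pi^1_1$ formulas. $\mathrm{Prop}$ is an infinite set of propositional variables. $\mathrm{Fml}_{\mathbf{CTL}}$ is the set of formulas built from $\mathrm{Prop}\cup\{\bot\}$ by $\varphi\to\psi$, $\mathsf{AX}\varphi$, $\mathsf{EG}\varphi$, $\varphi\,\mathsf{EU}\,\psi$, coded as natural numbers. Degree: $\deg(p)=\deg(\bot)=0$, $\deg(\varphi\to\psi)=\max\{\deg\varphi,\deg\psi\}$, $\deg(\mathsf{AX}\varphi)=\deg(\mathsf{EG}\varphi)=1+\deg\varphi$, $\deg(\varphi\,\mathsf{EU}\,\psi)=1+\max\{\deg\varphi,\deg\psi\}$; $\mathrm{Fml}_{\mathbf{CTL}}[n]$ is the set of formulas of degree $\le n$. A frame is a pair $(W,R)$ with $W\subseteq\mathbb{N}$ non-empty and $R\subseteq W\times W$; it is serial if $\forall w\in W\exists u\in W(wRu)$. A path from $w$ is a function $f:\mathbb{N}\to W$ with $f(0)=w$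 and $f(i)Rf(i+1)$ for all $i$. A $\mathbf{CTL}$-valuation on a serial frame $(W,R)$ is a function $V:W\times\mathrm{Fml}_{\mathbf{CTL}}\to\{0,1\}$ such that for all $w,\varphi,\psi$: $V(w,\bot)=0$; $V(w,\varphi\to\psi)=1-V(w,\varphi)(1-V(w,\psi))$; $V(w,\mathsf{AX}\varphi)=1\iff\forall u\in W(wRu\to V(u,\varphi)=1)$; $V(w,\mathsf{EG}\varphi)=1\iff$ there is a path $f$ from $w$ with $V(f(i),\varphi)=1$ for all $i\ge0$; $V(w,\varphi\,\mathsf{EU}\,\psi)=1\iff$ there are a path $f$ from $w$ and $i\ge0$ with $V(f(j),\varphi)=1$ for all $j<i$ and $V(f(i),\psi)=1$. An $n$-restricted $\mathbf{CTL}$-valuation has domain $W\times\mathrm{Fml}_{\mathbf{CTL}}[n]$ and satisfies these clauses for formulas in $\mathrm{Fml}_{\mathbf{CTL}}[n]$. *)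

theory Defs
  imports Main
begin

text \<open>
  Second-order arithmetic is treated as a two-sorted first-order theory.  A structure for its
  language consists of an arbitrary (possibly nonstandard) first-order part, whose domain is the
  type \<open>'a\<close>, and a family of subsets of that domain, over which the set variables range.
  "Over a theory, A implies B" is read as: every model of the theory that satisfies A satisfies B.
\<close>

record 'a L2_structure =
  zeroN :: 'a  ("\<zero>\<index>")
  oneN :: 'a  ("\<one>\<index>")
  addN :: "'a \<Rightarrow> 'a \<Rightarrow> 'a"  (infixl "\<oplus>\<index>" 65)
  mulN :: "'a \<Rightarrow> 'a \<Rightarrow> 'a"  (infixl "\<otimes>\<index>" 70)
  lessN :: "'a \<Rightarrow> 'a \<Rightarrow> bool"  (infix "\<prec>\<index>" 50)
  sets :: "'a set set"

section \<open>The language of second-order arithmetic\<close>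

datatype tm = Var nat | Zero | One | Add tm tm | Mul tm tm

text \<open>
  Number variables and set variables are two separate sorts, both named by natural numbers.
  Equality of sets is not primitive.
\<close>

datatype fm =
    Eq tm tm
  | Less tm tm
  | Mem tm nat
  | Neg fm
  | Conj fm fm
  | Disj fm fm
  | Imp fm fm
  | AllN nat fm
  | ExN nat fm
  | AllS nat fm
  | ExS nat fm

primrec eval :: "'a L2_structure \<Rightarrow> (nat \<Rightarrow> 'a) \<Rightarrow> tm \<Rightarrow> 'a" where
  "eval M e (Var x) = e x"
| "eval M e Zero = \<zero>\<^bsub>M\<^esub>"
| "eval M e One = \<one>\<^bsub>M\<^esub>"
| "eval M e (Add s t) = eval M e s \<oplus>\<^bsub>M\<^esub> eval M e t"
| "eval M e (Mul s t) = eval M e s \<otimes>\<^bsub>M\<^esub> eval M e t"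

primrec sat :: "'a L2_structure \<Rightarrow> (nat \<Rightarrow> 'a) \<Rightarrow> (nat \<Rightarrow> 'a set) \<Rightarrow> fm \<Rightarrow> bool" where
  "sat M e E (Eq s t) \<longleftrightarrow> eval M e s = eval M e t"
| "sat M e E (Less s t) \<longleftrightarrow> eval M e s \<prec>\<^bsub>M\<^esub> eval M e t"
| "sat M e E (Mem t X) \<longleftrightarrow> eval M e t \<in> E X"
| "sat M e E (Neg \<phi>) \<longleftrightarrow> \<not> sat M e E \<phi>"
| "sat M e E (Conj \<phi> \<psi>) \<longleftrightarrow> sat M e E \<phi> \<and> sat M e E \<psi>"
| "sat M e E (Disj \<phi> \<psi>) \<longleftrightarrow> sat M e E \<phi> \<or> sat M e E \<psi>"
| "sat M e E (Imp \<phi> \<psi>) \<longleftrightarrow> (sat M e E \<phi> \<longrightarrow> sat M e E \<psi>)"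
| "sat M e E (AllN x \<phi>) \<longleftrightarrow> (\<forall>a. sat M (e(x := a)) E \<phi>)"
| "sat M e E (ExN x \<phi>) \<longleftrightarrow> (\<exists>a. sat M (e(x := a)) E \<phi>)"
| "sat M e E (AllS X \<phi>) \<longleftrightarrow> (\<forall>A\<in>sets M. sat M e (E(X := A)) \<phi>)"
| "sat M e E (ExS X \<phi>) \<longleftrightarrow> (\<exists>A\<in>sets M. sat M e (E(X := A)) \<phi>)"

primrec tm_vars :: "tm \<Rightarrow> nat set" where
  "tm_vars (Var x) = {x}"
| "tm_vars Zero = {}"
| "tm_vars One = {}"
| "tm_vars (Add s t) = tm_vars s \<union> tm_vars t"
| "tm_vars (Mul s t) = tm_vars s \<union> tm_vars t"

inductive_set Delta00 :: "fm set" where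
  "Eq s t \<in> Delta00"
| "Less s t \<in> Delta00"
| "Mem t X \<in> Delta00"
| "\<phi> \<in> Delta00 \<Longrightarrow> Neg \<phi> \<in> Delta00"
| "\<phi> \<in> Delta00 \<Longrightarrow> \<psi> \<in> Delta00 \<Longrightarrow> Conj \<phi> \<psi> \<in> Delta00"
| "\<phi> \<in> Delta00 \<Longrightarrow> \<psi> \<in> Delta00 \<Longrightarrow> Disj \<phi> \<psi> \<in> Delta00"
| "\<phi> \<in> Delta00 \<Longrightarrow> \<psi> \<in> Delta00 \<Longrightarrow> Imp \<phi> \<psi> \<in> Delta00"
| "\<phi> \<in> Delta00 \<Longrightarrow> x \<notin> tm_vars t \<Longrightarrow> AllN x (Imp (Less (Var x) t) \<phi>) \<in> Delta00"
| "\<phi> \<in> Delta00 \<Longrightarrow> x \<notin> tm_vars t \<Longrightarrow> ExN x (Conj (Less (Var x) t) \<phi>) \<in> Delta00"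

definition Sigma01 :: "fm set" where
  "Sigma01 = {ExN x \<theta> |x \<theta>. \<theta> \<in> Delta00}"

definition Pi01 :: "fm set" where
  "Pi01 = {AllN x \<theta> |x \<theta>. \<theta> \<in> Delta00}"

primrec arithmetical :: "fm \<Rightarrow> bool" where
  "arithmetical (Eq s t) \<longleftrightarrow> True"
| "arithmetical (Less s t) \<longleftrightarrow> True"
| "arithmetical (Mem t X) \<longleftrightarrow> True"
| "arithmetical (Neg \<phi>) \<longleftrightarrow> arithmetical \<phi>"
| "arithmetical (Conj \<phi> \<psi>) \<longleftrightarrow> arithmetical \<phi> \<and> arithmetical \<psi>"
| "arithmetical (Disj \<phi> \<psi>) \<longleftrightarrow> arithmetical \<phi> \<and> arithmetical \<psi>"
| "arithmetical (Imp \<phi> \<psi>) \<longleftrightarrow> arithmetical \<phi> \<and> arithmetical \<psi>"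
| "arithmetical (AllN x \<phi>) \<longleftrightarrow> arithmetical \<phi>"
| "arithmetical (ExN x \<phi>) \<longleftrightarrow> arithmetical \<phi>"
| "arithmetical (AllS X \<phi>) \<longleftrightarrow> False"
| "arithmetical (ExS X \<phi>) \<longleftrightarrow> False"

definition Pi11 :: "fm set" where
  "Pi11 = {AllS X \<theta> |X \<theta>. arithmetical \<theta>}"

section \<open>The axiom systems\<close>

definition robinson :: "'a L2_structure \<Rightarrow> bool" where
  "robinson M \<longleftrightarrow>
     (\<forall>m. m \<oplus>\<^bsub>M\<^esub> \<one>\<^bsub>M\<^esub> \<noteq> \<zero>\<^bsub>M\<^esub>) \<and>
     (\<forall>m n. m \<oplus>\<^bsub>M\<^esub> \<one>\<^bsub>M\<^esub> = n \<oplus>\<^bsub>M\<^esub> \<one>\<^bsub>M\<^esub> \<longrightarrow> m = n) \<and>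
     (\<forall>m. m = \<zero>\<^bsub>M\<^esub> \<or> (\<exists>k. m = k \<oplus>\<^bsub>M\<^esub> \<one>\<^bsub>M\<^esub>)) \<and>
     (\<forall>m. m \<oplus>\<^bsub>M\<^esub> \<zero>\<^bsub>M\<^esub> = m) \<and>
     (\<forall>m n. m \<oplus>\<^bsub>M\<^esub> (n \<oplus>\<^bsub>M\<^esub> \<one>\<^bsub>M\<^esub>) = (m \<oplus>\<^bsub>M\<^esub> n) \<oplus>\<^bsub>M\<^esub> \<one>\<^bsub>M\<^esub>) \<and>
     (\<forall>m. m \<otimes>\<^bsub>M\<^esub> \<zero>\<^bsub>M\<^esub> = \<zero>\<^bsub>M\<^esub>) \<and>
     (\<forall>m n. m \<otimes>\<^bsub>M\<^esub> (n \<oplus>\<^bsub>M\<^esub> \<one>\<^bsub>M\<^esub>) = (m \<otimes>\<^bsub>M\<^esub> n) \<oplus>\<^bsub>M\<^esub> m) \<and>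
     (\<forall>m. \<not> m \<prec>\<^bsub>M\<^esub> \<zero>\<^bsub>M\<^esub>) \<and>
     (\<forall>m n. m \<prec>\<^bsub>M\<^esub> n \<oplus>\<^bsub>M\<^esub> \<one>\<^bsub>M\<^esub> \<longleftrightarrow> m \<prec>\<^bsub>M\<^esub> n \<or> m = n)"

text \<open>
  In the following schemes the assignments \<open>e\<close> and \<open>E\<close> supply arbitrary number and set parameters.
  The usual proviso on comprehension, that the set variable being introduced is not free in the
  formula, is automatic because the new set is not part of \<open>E\<close>.
\<close>

definition induction_scheme :: "'a L2_structure \<Rightarrow> fm set \<Rightarrow> bool" where
  "induction_scheme M \<Gamma> \<longleftrightarrow>
     (\<forall>\<phi>\<in>\<Gamma>. \<forall>x e E. range E \<subseteq> sets M \<longrightarrow>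
        sat M (e(x := \<zero>\<^bsub>M\<^esub>)) E \<phi> \<longrightarrow>
        (\<forall>a. sat M (e(x := a)) E \<phi> \<longrightarrow> sat M (e(x := a \<oplus>\<^bsub>M\<^esub> \<one>\<^bsub>M\<^esub>)) E \<phi>) \<longrightarrow>
        (\<forall>a. sat M (e(x := a)) E \<phi>))"

definition comprehension_scheme :: "'a L2_structure \<Rightarrow> fm set \<Rightarrow> bool" where
  "comprehension_scheme M \<Gamma> \<longleftrightarrow>
     (\<forall>\<phi>\<in>\<Gamma>. \<forall>x e E. range E \<subseteq> sets M \<longrightarrow>
        (\<exists>X\<in>sets M. \<forall>a. a \<in> X \<longleftrightarrow> sat M (e(x := a)) E \<phi>))"

definition Delta01_comprehension :: "'a L2_structure \<Rightarrow> bool" where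
  "Delta01_comprehension M \<longleftrightarrow>
     (\<forall>\<phi>\<in>Sigma01. \<forall>\<psi>\<in>Pi01. \<forall>x e E. range E \<subseteq> sets M \<longrightarrow>
        (\<forall>a. sat M (e(x := a)) E \<phi> \<longleftrightarrow> sat M (e(x := a)) E \<psi>) \<longrightarrow>
        (\<exists>X\<in>sets M. \<forall>a. a \<in> X \<longleftrightarrow> sat M (e(x := a)) E \<phi>))"

text \<open>
  As in first-order logic generally, the domain of the set sort is required to be non-empty; for
  the number sort this holds because types are non-empty.
\<close>

definition RCA0 :: "'a L2_structure \<Rightarrow> bool" where
  "RCA0 M \<longleftrightarrow> sets M \<noteq> {} \<and> robinson M \<and> induction_scheme M Sigma01 \<and> Delta01_comprehension M"

definition Pi11_CA0 :: "'a L2_structure \<Rightarrow> bool" where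
  "Pi11_CA0 M \<longleftrightarrow> RCA0 M \<and> comprehension_scheme M Pi11"

section \<open>Pairs and functions inside a structure\<close>

text \<open>
  From here on everything is the interpretation in \<open>M\<close> of a definition in second-order
  arithmetic: numbers are elements of \<open>M\<close>, and all sets and functions that are quantified over
  are (coded by) members of \<open>sets M\<close>.
\<close>

definition leN :: "'a L2_structure \<Rightarrow> 'a \<Rightarrow> 'a \<Rightarrow> bool"  (infix "\<preceq>\<index>" 50) where
  "m \<preceq>\<^bsub>M\<^esub> n \<longleftrightarrow> m \<prec>\<^bsub>M\<^esub> n \<or> m = n"

definition maxN :: "'a L2_structure \<Rightarrow> 'a \<Rightarrow> 'a \<Rightarrow> 'a" where
  "maxN M m n = (if m \<preceq>\<^bsub>M\<^esub> n then n else m)"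

text \<open>Only used when \<open>n\<close> is at most \<open>m\<close>.\<close>

definition minusN :: "'a L2_structure \<Rightarrow> 'a \<Rightarrow> 'a \<Rightarrow> 'a"  (infixl "\<ominus>\<index>" 65) where
  "m \<ominus>\<^bsub>M\<^esub> n = (THE k. n \<oplus>\<^bsub>M\<^esub> k = m)"

primrec numeralN :: "'a L2_structure \<Rightarrow> nat \<Rightarrow> 'a" where
  "numeralN M 0 = \<zero>\<^bsub>M\<^esub>"
| "numeralN M (Suc k) = numeralN M k \<oplus>\<^bsub>M\<^esub> \<one>\<^bsub>M\<^esub>"

text \<open>The pairing function customary in subsystems of second-order arithmetic; it is injective.\<close>

definition pairN :: "'a L2_structure \<Rightarrow> 'a \<Rightarrow> 'a \<Rightarrow> 'a" where
  "pairN M a b = (a \<oplus>\<^bsub>M\<^esub> b) \<otimes>\<^bsub>M\<^esub> (a \<oplus>\<^bsub>M\<^esub> b) \<oplus>\<^bsub>M\<^esub> a"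

definition prodN :: "'a L2_structure \<Rightarrow> 'a set \<Rightarrow> 'a set \<Rightarrow> 'a set" where
  "prodN M A B = {pairN M a b |a b. a \<in> A \<and> b \<in> B}"

definition is_function :: "'a L2_structure \<Rightarrow> 'a set \<Rightarrow> 'a set \<Rightarrow> 'a set \<Rightarrow> bool" where
  "is_function M f A B \<longleftrightarrow>
     f \<in> sets M \<and> f \<subseteq> prodN M A B \<and> (\<forall>a\<in>A. \<exists>!b. pairN M a b \<in> f)"

definition app :: "'a L2_structure \<Rightarrow> 'a set \<Rightarrow> 'a \<Rightarrow> 'a" where
  "app M f a = (THE b. pairN M a b \<in> f)"

section \<open>Codes of CTL formulas\<close>

definition Bot :: "'a L2_structure \<Rightarrow> 'a" where
  "Bot M = pairN M (numeralN M 0) (numeralN M 0)"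

definition PVar :: "'a L2_structure \<Rightarrow> 'a \<Rightarrow> 'a" where
  "PVar M k = pairN M (numeralN M 1) k"

definition Impl :: "'a L2_structure \<Rightarrow> 'a \<Rightarrow> 'a \<Rightarrow> 'a" where
  "Impl M \<phi> \<psi> = pairN M (numeralN M 2) (pairN M \<phi> \<psi>)"

definition AX :: "'a L2_structure \<Rightarrow> 'a \<Rightarrow> 'a" where
  "AX M \<phi> = pairN M (numeralN M 3) \<phi>"

definition EG :: "'a L2_structure \<Rightarrow> 'a \<Rightarrow> 'a" where
  "EG M \<phi> = pairN M (numeralN M 4) \<phi>"

definition EU :: "'a L2_structure \<Rightarrow> 'a \<Rightarrow> 'a \<Rightarrow> 'a" where
  "EU M \<phi> \<psi> = pairN M (numeralN M 5) (pairN M \<phi> \<psi>)"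

definition Props :: "'a L2_structure \<Rightarrow> 'a set" where
  "Props M = range (PVar M)"

text \<open>
  The recursive definitions of formula and degree, carried out inside \<open>M\<close>: \<open>\<phi>\<close> is a formula of
  degree \<open>d\<close> iff this is witnessed by a set \<open>D\<close> in which every pair (formula, degree) is obtained
  by one of the recursive clauses from pairs in \<open>D\<close>.  As immediate subformulas have smaller codes,
  induction in \<open>M\<close> shows that such a \<open>D\<close> contains only correct pairs, and the degree of a formula
  is unique.  An inductive definition on the level of HOL would instead only produce formulas of
  standard finite length.
\<close>

definition degree_clauses :: "'a L2_structure \<Rightarrow> 'a set \<Rightarrow> 'a \<Rightarrow> 'a \<Rightarrow> bool" where
  "degree_clauses M D \<phi> d \<longleftrightarrow>
     (\<phi> \<in> Props M \<and> d = \<zero>\<^bsub>M\<^esub>) \<or>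
     (\<phi> = Bot M \<and> d = \<zero>\<^bsub>M\<^esub>) \<or>
     (\<exists>\<psi> \<chi> i j. \<phi> = Impl M \<psi> \<chi> \<and> pairN M \<psi> i \<in> D \<and> pairN M \<chi> j \<in> D \<and> d = maxN M i j) \<or>
     (\<exists>\<psi> i. \<phi> = AX M \<psi> \<and> pairN M \<psi> i \<in> D \<and> d = \<one>\<^bsub>M\<^esub> \<oplus>\<^bsub>M\<^esub> i) \<or>
     (\<exists>\<psi> i. \<phi> = EG M \<psi> \<and> pairN M \<psi> i \<in> D \<and> d = \<one>\<^bsub>M\<^esub> \<oplus>\<^bsub>M\<^esub> i) \<or>
     (\<exists>\<psi> \<chi> i j. \<phi> = EU M \<psi> \<chi> \<and> pairN M \<psi> i \<in> D \<and> pairN M \<chi> j \<in> D \<and>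
        d = \<one>\<^bsub>M\<^esub> \<oplus>\<^bsub>M\<^esub> maxN M i j)"

definition has_degree :: "'a L2_structure \<Rightarrow> 'a \<Rightarrow> 'a \<Rightarrow> bool" where
  "has_degree M \<phi> d \<longleftrightarrow>
     (\<exists>D\<in>sets M. pairN M \<phi> d \<in> D \<and>
        (\<forall>\<psi> i. pairN M \<psi> i \<in> D \<longrightarrow> degree_clauses M D \<psi> i))"

definition Fml_upto :: "'a L2_structure \<Rightarrow> 'a \<Rightarrow> 'a set" where
  "Fml_upto M n = {\<phi>. \<exists>d. has_degree M \<phi> d \<and> d \<preceq>\<^bsub>M\<^esub> n}"

section \<open>Frames, paths and valuations\<close>

definition frame :: "'a L2_structure \<Rightarrow> 'a set \<Rightarrow> 'a set \<Rightarrow> bool" where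
  "frame M W R \<longleftrightarrow> W \<in> sets M \<and> R \<in> sets M \<and> W \<noteq> {} \<and> R \<subseteq> prodN M W W"

definition serial :: "'a L2_structure \<Rightarrow> 'a set \<Rightarrow> 'a set \<Rightarrow> bool" where
  "serial M W R \<longleftrightarrow> (\<forall>w\<in>W. \<exists>u\<in>W. pairN M w u \<in> R)"

definition is_path :: "'a L2_structure \<Rightarrow> 'a set \<Rightarrow> 'a set \<Rightarrow> 'a \<Rightarrow> 'a set \<Rightarrow> bool" where
  "is_path M W R w f \<longleftrightarrow>
     is_function M f UNIV W \<and> app M f \<zero>\<^bsub>M\<^esub> = w \<and>
     (\<forall>i. pairN M (app M f i) (app M f (i \<oplus>\<^bsub>M\<^esub> \<one>\<^bsub>M\<^esub>)) \<in> R)"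

abbreviation val :: "'a L2_structure \<Rightarrow> 'a set \<Rightarrow> 'a \<Rightarrow> 'a \<Rightarrow> 'a" where
  "val M V w \<phi> \<equiv> app M V (pairN M w \<phi>)"

definition restricted_valuation ::
    "'a L2_structure \<Rightarrow> 'a set \<Rightarrow> 'a set \<Rightarrow> 'a \<Rightarrow> 'a set \<Rightarrow> bool" where
  "restricted_valuation M W R n V \<longleftrightarrow>
     is_function M V (prodN M W (Fml_upto M n)) {\<zero>\<^bsub>M\<^esub>, \<one>\<^bsub>M\<^esub>} \<and>
     (\<forall>w\<in>W.
        val M V w (Bot M) = \<zero>\<^bsub>M\<^esub> \<and>
        (\<forall>\<phi> \<psi>. Impl M \<phi> \<psi> \<in> Fml_upto M n \<longrightarrow>
           val M V w (Impl M \<phi> \<psi>) =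
             \<one>\<^bsub>M\<^esub> \<ominus>\<^bsub>M\<^esub> val M V w \<phi> \<otimes>\<^bsub>M\<^esub> (\<one>\<^bsub>M\<^esub> \<ominus>\<^bsub>M\<^esub> val M V w \<psi>)) \<and>
        (\<forall>\<phi>. AX M \<phi> \<in> Fml_upto M n \<longrightarrow>
           (val M V w (AX M \<phi>) = \<one>\<^bsub>M\<^esub> \<longleftrightarrow>
             (\<forall>u\<in>W. pairN M w u \<in> R \<longrightarrow> val M V u \<phi> = \<one>\<^bsub>M\<^esub>))) \<and>
        (\<forall>\<phi>. EG M \<phi> \<in> Fml_upto M n \<longrightarrow>
           (val M V w (EG M \<phi>) = \<one>\<^bsub>M\<^esub> \<longleftrightarrow>
             (\<exists>f. is_path M W R w f \<and> (\<forall>i. val M V (app M f i) \<phi> = \<one>\<^bsub>M\<^esub>)))) \<and>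
        (\<forall>\<phi> \<psi>. EU M \<phi> \<psi> \<in> Fml_upto M n \<longrightarrow>
           (val M V w (EU M \<phi> \<psi>) = \<one>\<^bsub>M\<^esub> \<longleftrightarrow>
             (\<exists>f i. is_path M W R w f \<and>
                (\<forall>j. j \<prec>\<^bsub>M\<^esub> i \<longrightarrow> val M V (app M f j) \<phi> = \<one>\<^bsub>M\<^esub>) \<and>
                val M V (app M f i) \<psi> = \<one>\<^bsub>M\<^esub>))))"

definition restricted_valuation_extension_CTL :: "'a L2_structure \<Rightarrow> bool" where
  "restricted_valuation_extension_CTL M \<longleftrightarrow>
     (\<forall>W R n v. frame M W R \<and> serial M W R \<and>
        is_function M v (prodN M W (Props M)) {\<zero>\<^bsub>M\<^esub>, \<one>\<^bsub>M\<^esub>} \<longrightarrow>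
        (\<exists>V. restricted_valuation M W R n V \<and>
           (\<forall>w\<in>W. \<forall>p\<in>Props M. val M V w p = val M v w p)))"

end

theory Submission
  imports Defs "HOL-Library.Countable"
begin

text \<open>
  Only formulas \<open>EG p\<close> with a propositional variable \<open>p\<close> are needed.  On a bounded-definable
  graph, with a sink added to make it serial, the valuation of \<open>EG p\<close> yields the set of all
  points from which an infinite path starts.  That set is a fixpoint (a point belongs to it iff some
  successor does) and contains all points with a loop, which gives, without coding sequences,
  \<open>\<Sigma>\<^sup>0\<^sub>1\<close> comprehension and hence arithmetical comprehension, as well as the membership relation
  of lists built from pairs.  Next, comprehension follows for conditions "some function \<open>F\<close> has no
  three entries in a forbidden configuration": the finite approximations of \<open>F\<close> form a tree, and \<open>F\<close> is
  an infinite path in it.  Finally, \<open>\<exists>X. \<not> \<theta>(a, X)\<close> for arithmetical \<open>\<theta>\<close> is such a condition: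
  \<open>F\<close> collects the truth tables of all subformulas of \<open>\<theta>\<close>, with witnesses for the existential ones.
\<close>

section \<open>Renaming in bounded formulas\<close>

text \<open>The obstacle is the weakness of the base: in a possibly nonstandard model, comprehension
  is at first available only for conditions with no unbounded search, and sequence codes are not at
  hand. The unbounded quantifier enters through a single door: choosing the next point of a path is
  an unbounded search even if the edge relation is bounded. Fixpoints need not be unique, but the
  auxiliary relations lead into a loop or a dead end, so the fixpoint equation and the loops settle
  membership; real paths matter only for the tree.

  A set obtained in this way may serve as a parameter of a new bounded formula. Hence the one
  predicate \<open>bdef\<close> is later closed under all number quantifiers, and its comprehension
  and induction rules turn into arithmetical ones without being restated.

  Three entries suffice because the largest Tarski clause, that of conjunction, relates a formula to
  two immediate subformulas. The formulas are standard, so induction over them and the bound on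
  their variables live outside the model, and no truth predicate inside the model is
  required.\<close>

primrec tm_ren :: "(nat \<Rightarrow> nat) \<Rightarrow> tm \<Rightarrow> tm" where
  "tm_ren f (Var x) = Var (f x)"
| "tm_ren f Zero = Zero"
| "tm_ren f One = One"
| "tm_ren f (Add s t) = Add (tm_ren f s) (tm_ren f t)"
| "tm_ren f (Mul s t) = Mul (tm_ren f s) (tm_ren f t)"

lemma eval_tm_ren: "eval M e (tm_ren f t) = eval M (e \<circ> f) t"
  by (induction t) auto

lemma tm_vars_tm_ren: "tm_vars (tm_ren f t) = f ` tm_vars t"
  by (induction t) auto

lemma eval_cong: "(\<And>x. x \<in> tm_vars t \<Longrightarrow> e x = e' x) \<Longrightarrow> eval M e t = eval M e' t"
  by (induction t) auto

lemma finite_tm_vars: "finite (tm_vars t)"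
  by (induction t) auto

primrec fm_vars :: "fm \<Rightarrow> nat set" where
  "fm_vars (Eq s t) = tm_vars s \<union> tm_vars t"
| "fm_vars (Less s t) = tm_vars s \<union> tm_vars t"
| "fm_vars (Mem t X) = tm_vars t"
| "fm_vars (Neg \<phi>) = fm_vars \<phi>"
| "fm_vars (Conj \<phi> \<psi>) = fm_vars \<phi> \<union> fm_vars \<psi>"
| "fm_vars (Disj \<phi> \<psi>) = fm_vars \<phi> \<union> fm_vars \<psi>"
| "fm_vars (Imp \<phi> \<psi>) = fm_vars \<phi> \<union> fm_vars \<psi>"
| "fm_vars (AllN x \<phi>) = insert x (fm_vars \<phi>)"
| "fm_vars (ExN x \<phi>) = insert x (fm_vars \<phi>)"
| "fm_vars (AllS X \<phi>) = fm_vars \<phi>"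
| "fm_vars (ExS X \<phi>) = fm_vars \<phi>"

lemma finite_fm_vars: "finite (fm_vars \<phi>)"
  by (induction \<phi>) (auto simp: finite_tm_vars)

lemma sat_cong:
  "(\<And>x. x \<in> fm_vars \<phi> \<Longrightarrow> e x = e' x) \<Longrightarrow> sat M e E \<phi> \<longleftrightarrow> sat M e' E \<phi>"
proof (induction \<phi> arbitrary: e e' E)
  case (Eq s t)
  then show ?case using eval_cong[of s e e' M] eval_cong[of t e e' M] by simp
next
  case (Less s t)
  then show ?case using eval_cong[of s e e' M] eval_cong[of t e e' M] by simp
next
  case (Mem t X)
  then show ?case using eval_cong[of t e e' M] by simp
next
  case (Neg \<phi>)
  have "sat M e E \<phi> = sat M e' E \<phi>" by (rule Neg.IH) (use Neg.prems in auto)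
  then show ?case by (simp only: sat.simps)
next
  case (Conj \<phi> \<psi>)
  have "sat M e E \<phi> = sat M e' E \<phi>" by (rule Conj.IH) (use Conj.prems in auto)
  moreover have "sat M e E \<psi> = sat M e' E \<psi>" by (rule Conj.IH) (use Conj.prems in auto)
  ultimately show ?case by (simp only: sat.simps)
next
  case (Disj \<phi> \<psi>)
  have "sat M e E \<phi> = sat M e' E \<phi>" by (rule Disj.IH) (use Disj.prems in auto)
  moreover have "sat M e E \<psi> = sat M e' E \<psi>" by (rule Disj.IH) (use Disj.prems in auto)
  ultimately show ?case by (simp only: sat.simps)
next
  case (Imp \<phi> \<psi>)
  have "sat M e E \<phi> = sat M e' E \<phi>" by (rule Imp.IH) (use Imp.prems in auto)
  moreover have "sat M e E \<psi> = sat M e' E \<psi>" by (rule Imp.IH) (use Imp.prems in auto)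
  ultimately show ?case by (simp only: sat.simps)
next
  case (AllN x \<phi>)
  have "sat M (e(x := a)) E \<phi> = sat M (e'(x := a)) E \<phi>" for a
    by (rule AllN.IH) (use AllN.prems in auto)
  then show ?case by (simp only: sat.simps)
next
  case (ExN x \<phi>)
  have "sat M (e(x := a)) E \<phi> = sat M (e'(x := a)) E \<phi>" for a
    by (rule ExN.IH) (use ExN.prems in auto)
  then show ?case by (simp only: sat.simps)
next
  case (AllS X \<phi>)
  have "sat M e (E(X := A)) \<phi> = sat M e' (E(X := A)) \<phi>" for A
    by (rule AllS.IH) (use AllS.prems in auto)
  then show ?case by (simp only: sat.simps)
next
  case (ExS X \<phi>)
  have "sat M e (E(X := A)) \<phi> = sat M e' (E(X := A)) \<phi>" for A
    by (rule ExS.IH) (use ExS.prems in auto)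
  then show ?case by (simp only: sat.simps)
qed

lemma upd_comp_fresh: "y \<notin> range f \<Longrightarrow> e(y := a) \<circ> f(x := y) = (e \<circ> f)(x := a)"
  by (auto simp: fun_eq_iff)

lemma upd_comp_fresh': "y \<notin> range f \<Longrightarrow> e(y := a) \<circ> f = e \<circ> f"
  by (auto simp: fun_eq_iff)

text \<open>The co-infinite range leaves room for renaming bound variables, so no capture occurs.\<close>

lemma Delta00_ren:
  assumes "\<phi> \<in> Delta00" "infinite (- range f)"
  shows "\<exists>\<psi>\<in>Delta00. \<forall>e E. sat M e E \<psi> \<longleftrightarrow> sat M (e \<circ> f) (E \<circ> g) \<phi>"
  using assms
proof (induction \<phi> arbitrary: f)
  case (1 s t)
  show ?case
    by (rule bexI[where x = "Eq (tm_ren f s) (tm_ren f t)"]) (auto simp: eval_tm_ren comp_def intro: Delta00.intros)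
next
  case (2 s t)
  show ?case
    by (rule bexI[where x = "Less (tm_ren f s) (tm_ren f t)"]) (auto simp: eval_tm_ren comp_def intro: Delta00.intros)
next
  case (3 t X)
  show ?case
    by (rule bexI[where x = "Mem (tm_ren f t) (g X)"]) (auto simp: eval_tm_ren comp_def intro: Delta00.intros)
next
  case (4 \<phi>)
  from 4(2)[OF 4(3)] obtain \<phi>' where 1: "\<phi>' \<in> Delta00" and 2: "\<And>e E. sat M e E \<phi>' \<longleftrightarrow> sat M (e \<circ> f) (E \<circ> g) \<phi>"
    by blast
  show ?case
    by (rule bexI[where x = "Neg \<phi>'"]) (simp_all only: sat.simps 2 Delta00.intros 1 simp_thms)
next
  case (5 \<phi> \<psi>)
  from 5(3)[OF 5(5)] 5(4)[OF 5(5)] obtain \<phi>' \<psi>' where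
    1: "\<phi>' \<in> Delta00" and 2: "\<And>e E. sat M e E \<phi>' \<longleftrightarrow> sat M (e \<circ> f) (E \<circ> g) \<phi>"
    and 3: "\<psi>' \<in> Delta00" and 4: "\<And>e E. sat M e E \<psi>' \<longleftrightarrow> sat M (e \<circ> f) (E \<circ> g) \<psi>"
    by blast
  show ?case
    by (rule bexI[where x = "Conj \<phi>' \<psi>'"]) (simp_all only: sat.simps 2 4 Delta00.intros 1 3 simp_thms)
next
  case (6 \<phi> \<psi>)
  from 6(3)[OF 6(5)] 6(4)[OF 6(5)] obtain \<phi>' \<psi>' where
    1: "\<phi>' \<in> Delta00" and 2: "\<And>e E. sat M e E \<phi>' \<longleftrightarrow> sat M (e \<circ> f) (E \<circ> g) \<phi>"
    and 3: "\<psi>' \<in> Delta00" and 4: "\<And>e E. sat M e E \<psi>' \<longleftrightarrow> sat M (e \<circ> f) (E \<circ> g) \<psi>"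
    by blast
  show ?case
    by (rule bexI[where x = "Disj \<phi>' \<psi>'"]) (simp_all only: sat.simps 2 4 Delta00.intros 1 3 simp_thms)
next
  case (7 \<phi> \<psi>)
  from 7(3)[OF 7(5)] 7(4)[OF 7(5)] obtain \<phi>' \<psi>' where
    1: "\<phi>' \<in> Delta00" and 2: "\<And>e E. sat M e E \<phi>' \<longleftrightarrow> sat M (e \<circ> f) (E \<circ> g) \<phi>"
    and 3: "\<psi>' \<in> Delta00" and 4: "\<And>e E. sat M e E \<psi>' \<longleftrightarrow> sat M (e \<circ> f) (E \<circ> g) \<psi>"
    by blast
  show ?case
    by (rule bexI[where x = "Imp \<phi>' \<psi>'"]) (simp_all only: sat.simps 2 4 Delta00.intros 1 3 simp_thms)
next
  case (8 \<phi> x t)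
  obtain y where y: "y \<notin> range f" using 8(4) by (metis ComplD finite.emptyI all_not_in_conv)
  have "- range f \<subseteq> insert y (- range (f(x := y)))" by auto
  then have "infinite (- range (f(x := y)))" using 8(4) finite_subset by blast
  from 8(3)[OF this] obtain \<phi>' where \<phi>': "\<phi>' \<in> Delta00"
    "\<And>e E. sat M e E \<phi>' \<longleftrightarrow> sat M (e \<circ> f(x := y)) (E \<circ> g) \<phi>" by blast
  have t: "eval M ((e \<circ> f)(x := a)) t = eval M (e \<circ> f) t" for e a
    using 8(2) by (intro eval_cong) auto
  show ?case
  proof (rule bexI[where x = "AllN y (Imp (Less (Var y) (tm_ren f t)) \<phi>')"], intro allI)
    fix e E
    show "sat M e E (AllN y (Imp (Less (Var y) (tm_ren f t)) \<phi>')) \<longleftrightarrow>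
          sat M (e \<circ> f) (E \<circ> g) (AllN x (Imp (Less (Var x) t) \<phi>))"
      by (simp only: sat.simps eval.simps eval_tm_ren \<phi>'(2) upd_comp_fresh[OF y] upd_comp_fresh'[OF y] t fun_upd_same)
    show "AllN y (Imp (Less (Var y) (tm_ren f t)) \<phi>') \<in> Delta00"
      using y by (intro Delta00.intros \<phi>') (auto simp: tm_vars_tm_ren)
  qed
next
  case (9 \<phi> x t)
  obtain y where y: "y \<notin> range f" using 9(4) by (metis ComplD finite.emptyI all_not_in_conv)
  have "- range f \<subseteq> insert y (- range (f(x := y)))" by auto
  then have "infinite (- range (f(x := y)))" using 9(4) finite_subset by blast
  from 9(3)[OF this] obtain \<phi>' where \<phi>': "\<phi>' \<in> Delta00"
    "\<And>e E. sat M e E \<phi>' \<longleftrightarrow> sat M (e \<circ> f(x := y)) (E \<circ> g) \<phi>" by blast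
  have t: "eval M ((e \<circ> f)(x := a)) t = eval M (e \<circ> f) t" for e a
    using 9(2) by (intro eval_cong) auto
  show ?case
  proof (rule bexI[where x = "ExN y (Conj (Less (Var y) (tm_ren f t)) \<phi>')"], intro allI)
    fix e E
    show "sat M e E (ExN y (Conj (Less (Var y) (tm_ren f t)) \<phi>')) \<longleftrightarrow>
          sat M (e \<circ> f) (E \<circ> g) (ExN x (Conj (Less (Var x) t) \<phi>))"
      by (simp only: sat.simps eval.simps eval_tm_ren \<phi>'(2) upd_comp_fresh[OF y] upd_comp_fresh'[OF y] t fun_upd_same)
    show "ExN y (Conj (Less (Var y) (tm_ren f t)) \<phi>') \<in> Delta00"
      using y by (intro Delta00.intros \<phi>') (auto simp: tm_vars_tm_ren)
  qed
qed

definition inst :: "(nat \<Rightarrow> nat + 'a) \<Rightarrow> (nat \<Rightarrow> 'a) \<Rightarrow> nat \<Rightarrow> 'a" where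
  "inst \<tau> e n = (case \<tau> n of Inl m \<Rightarrow> e m | Inr c \<Rightarrow> c)"

text \<open>Residue class 2 modulo 3 is reserved: renamings that avoid it leave infinitely many
  fresh names for the bound variables in \<open>Delta00_ren\<close>.\<close>

lemma infinite_co_range:
  assumes "\<And>n k. f n \<noteq> 3 * k + (2::nat)"
  shows "infinite (- range f)"
proof -
  have "range (\<lambda>k. 3 * k + 2) \<subseteq> - range f" 
  proof
    fix x assume "x \<in> range (\<lambda>k. 3 * k + (2::nat))"
    then obtain k where k: "x = 3 * k + 2" by blast
    show "x \<in> - range f"
    proof
      assume "x \<in> range f"
      then obtain n where "f n = x" by blast
      then show False using assms[of n k] k by blast
    qed
  qed
  moreover have "infinite (range (\<lambda>k::nat. 3 * k + 2))"
    by (simp add: finite_image_iff inj_on_def)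
  ultimately show ?thesis using infinite_super by blast
qed

section \<open>Definability by bounded formulas\<close>

locale rca0 =
  fixes M :: "'a L2_structure" (structure)
  assumes rca0: "RCA0 M"
begin

text \<open>The map \<open>\<tau>\<close> identifies each variable of the formula with a component of the environment or
  with a number parameter; \<open>E\<close> supplies the set parameters.  In the rules for quantifiers the bound
  variable is component 0 and the other components are shifted.\<close>

definition bdef :: "((nat \<Rightarrow> 'a) \<Rightarrow> bool) \<Rightarrow> bool" where
  "bdef P \<longleftrightarrow> (\<exists>\<phi>\<in>Delta00. \<exists>\<tau> E. range E \<subseteq> sets M \<and> (\<forall>e. P e \<longleftrightarrow> sat M (inst \<tau> e) E \<phi>))"

definition tdef :: "((nat \<Rightarrow> 'a) \<Rightarrow> 'a) \<Rightarrow> bool" where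
  "tdef T \<longleftrightarrow> (\<exists>t \<tau>. \<forall>e. T e = eval M (inst \<tau> e) t)"

lemma tdefI: "(\<And>e. T e = eval M (inst \<tau> e) t) \<Longrightarrow> tdef T"
  unfolding tdef_def by blast

lemma bdefI: "\<phi> \<in> Delta00 \<Longrightarrow> range E \<subseteq> sets M \<Longrightarrow> (\<And>e. P e \<longleftrightarrow> sat M (inst \<tau> e) E \<phi>) \<Longrightarrow> bdef P"
  unfolding bdef_def by blast

lemma tdefE:
  assumes "tdef T" obtains t \<tau> where "\<And>e. T e = eval M (inst \<tau> e) t"
  using assms unfolding tdef_def by blast

lemma bdefE:
  assumes "bdef P"
  obtains \<phi> \<tau> E where "\<phi> \<in> Delta00" "range E \<subseteq> sets M" "\<And>e. P e \<longleftrightarrow> sat M (inst \<tau> e) E \<phi>"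
  using assms unfolding bdef_def by metis

text \<open>Puts two unrelated parameter assignments into residue classes 0 and 1 modulo 3, so that
  formulas renamed by \<open>3 * n\<close> and \<open>3 * n + 1\<close> can be combined under one
  assignment.\<close>

definition join :: "(nat \<Rightarrow> 'b) \<Rightarrow> (nat \<Rightarrow> 'b) \<Rightarrow> nat \<Rightarrow> 'b" where
  "join f g n = (if n mod 3 = 0 then f (n div 3) else g (n div 3))"

lemma div3: "Suc (3 * n) div 3 = n" "(3 * n + 1) div 3 = (n::nat)"
  by presburger+

lemma inst_join:
  "inst (join \<tau> \<tau>') e \<circ> (\<lambda>n. 3 * n) = inst \<tau> e"
  "inst (join \<tau> \<tau>') e \<circ> (\<lambda>n. 3 * n + 1) = inst \<tau>' e"
  by (auto simp: fun_eq_iff inst_def join_def div3)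

lemma join_comp: "join E E' \<circ> (\<lambda>n. 3 * n) = E" "join E E' \<circ> (\<lambda>n. 3 * n + 1) = E'"
  by (auto simp: fun_eq_iff join_def div3)

lemma range_join: "range E \<subseteq> S \<Longrightarrow> range E' \<subseteq> S \<Longrightarrow> range (join E E') \<subseteq> S"
  by (auto simp: join_def)

lemma infinite_co_range3: "infinite (- range (\<lambda>n::nat. 3 * n))" "infinite (- range (\<lambda>n::nat. 3 * n + 1))"
  by (rule infinite_co_range; presburger)+

lemma tdef_binary:
  assumes "tdef T" "tdef U"
  obtains t u \<tau> where "\<And>e. T e = eval M (inst \<tau> e) t" "\<And>e. U e = eval M (inst \<tau> e) u"
proof -
  obtain t \<tau> where "\<And>e. T e = eval M (inst \<tau> e) t" using assms(1) by (rule tdefE) (rule that)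
  moreover obtain u \<tau>' where "\<And>e. U e = eval M (inst \<tau>' e) u" using assms(2) by (rule tdefE) (rule that)
  ultimately have "T e = eval M (inst (join \<tau> \<tau>') e) (tm_ren (\<lambda>n. 3 * n) t)"
    "U e = eval M (inst (join \<tau> \<tau>') e) (tm_ren (\<lambda>n. 3 * n + 1) u)" for e
    by (simp_all add: eval_tm_ren inst_join del: One_nat_def add_Suc_right)
  then show thesis by (rule that)
qed

lemma bdef_binary:
  assumes "bdef P" "bdef Q"
  obtains \<phi> \<psi> \<tau> E where "\<phi> \<in> Delta00" "\<psi> \<in> Delta00" "range E \<subseteq> sets M"
    "\<And>e. P e \<longleftrightarrow> sat M (inst \<tau> e) E \<phi>" "\<And>e. Q e \<longleftrightarrow> sat M (inst \<tau> e) E \<psi>"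
proof -
  obtain \<phi> \<tau> E where 0: "\<phi> \<in> Delta00" "range E \<subseteq> sets M" "\<And>e. P e \<longleftrightarrow> sat M (inst \<tau> e) E \<phi>"
    using assms(1) by (rule bdefE) (rule that)
  obtain \<psi> \<tau>' E' where 1: "\<psi> \<in> Delta00" "range E' \<subseteq> sets M" "\<And>e. Q e \<longleftrightarrow> sat M (inst \<tau>' e) E' \<psi>"
    using assms(2) by (rule bdefE) (rule that)
  from Delta00_ren[OF 0(1) infinite_co_range3(1), of M "\<lambda>n. 3 * n"]
  obtain \<phi>' where 2: "\<phi>' \<in> Delta00"
    "\<And>e E. sat M e E \<phi>' \<longleftrightarrow> sat M (e \<circ> (\<lambda>n. 3 * n)) (E \<circ> (\<lambda>n. 3 * n)) \<phi>" by blast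
  from Delta00_ren[OF 1(1) infinite_co_range3(2), of M "\<lambda>n. 3 * n + 1"]
  obtain \<psi>' where 3: "\<psi>' \<in> Delta00"
    "\<And>e E. sat M e E \<psi>' \<longleftrightarrow> sat M (e \<circ> (\<lambda>n. 3 * n + 1)) (E \<circ> (\<lambda>n. 3 * n + 1)) \<psi>" by blast
  show thesis
  proof (rule that)
    show "P e \<longleftrightarrow> sat M (inst (join \<tau> \<tau>') e) (join E E') \<phi>'" for e
      unfolding 2(2) inst_join join_comp by (rule 0(3))
    show "Q e \<longleftrightarrow> sat M (inst (join \<tau> \<tau>') e) (join E E') \<psi>'" for e
      unfolding 3(2) inst_join join_comp by (rule 1(3))
  qed (rule 2(1) 3(1) range_join 0(2) 1(2))+
qed

lemma some_set: obtains E :: "nat \<Rightarrow> 'a set" where "range E \<subseteq> sets M"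
proof -
  obtain A where "A \<in> sets M" using rca0 unfolding RCA0_def by blast
  then have "range (\<lambda>_::nat. A) \<subseteq> sets M" by blast
  then show thesis by (rule that)
qed

section \<open>Closure properties of definable terms and conditions\<close>

lemma tdef_var: "tdef (\<lambda>e. e n)"
  by (rule tdefI[where t = "Var 0" and \<tau> = "\<lambda>_. Inl n"]) (simp add: inst_def)

lemma tdef_const: "tdef (\<lambda>e. c)"
  by (rule tdefI[where t = "Var 0" and \<tau> = "\<lambda>_. Inr c"]) (simp add: inst_def)

lemma tdef_add:
  assumes "tdef T" "tdef U" shows "tdef (\<lambda>e. T e \<oplus> U e)"
proof -
  obtain t u \<tau> where "\<And>e. T e = eval M (inst \<tau> e) t" "\<And>e. U e = eval M (inst \<tau> e) u"
    using assms by (rule tdef_binary) (rule that)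
  then show ?thesis by (intro tdefI[where t = "Add t u" and \<tau> = \<tau>]) simp
qed

lemma tdef_mul:
  assumes "tdef T" "tdef U" shows "tdef (\<lambda>e. T e \<otimes> U e)"
proof -
  obtain t u \<tau> where "\<And>e. T e = eval M (inst \<tau> e) t" "\<And>e. U e = eval M (inst \<tau> e) u"
    using assms by (rule tdef_binary) (rule that)
  then show ?thesis by (intro tdefI[where t = "Mul t u" and \<tau> = \<tau>]) simp
qed

lemma tdef_pair: "tdef T \<Longrightarrow> tdef U \<Longrightarrow> tdef (\<lambda>e. pairN M (T e) (U e))"
  unfolding pairN_def by (intro tdef_add tdef_mul)

lemma inst_ren:
  "inst (\<lambda>n. case \<tau> n of Inl m \<Rightarrow> \<rho> m | Inr c \<Rightarrow> Inr c) e = inst \<tau> (inst \<rho> e)"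
  by (auto simp: fun_eq_iff inst_def split: sum.splits)

lemma inst_Inl: "inst (\<lambda>n. Inl (k n)) e = (\<lambda>n. e (k n))"
  by (auto simp: inst_def)

lemma bdef_inst:
  assumes "bdef P" shows "bdef (\<lambda>e. P (inst \<rho> e))"
proof -
  obtain \<phi> \<tau> E where 1: "\<phi> \<in> Delta00" "range E \<subseteq> sets M" "\<And>e. P e \<longleftrightarrow> sat M (inst \<tau> e) E \<phi>"
    using assms by (rule bdefE) (rule that)
  show ?thesis
    by (rule bdefI[OF 1(1,2), where \<tau> = "\<lambda>n. case \<tau> n of Inl m \<Rightarrow> \<rho> m | Inr c \<Rightarrow> Inr c"])
      (simp only: 1(3) inst_ren)
qed

lemma bdef_ren: "bdef P \<Longrightarrow> bdef (\<lambda>e. P (\<lambda>n. e (k n)))"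
  using bdef_inst[of P "\<lambda>n. Inl (k n)"] by (simp only: inst_Inl)

lemma tdef_ren:
  assumes "tdef T" shows "tdef (\<lambda>e. T (\<lambda>n. e (k n)))"
proof -
  obtain t \<tau> where 1: "\<And>e. T e = eval M (inst \<tau> e) t"
    using assms(1) by (rule tdefE) (rule that)
  show ?thesis
    by (rule tdefI[where t = t and \<tau> = "\<lambda>n. case \<tau> n of Inl m \<Rightarrow> Inl (k m) | Inr c \<Rightarrow> Inr c"])
      (simp only: 1 inst_ren inst_Inl)
qed

lemma bdef_eq:
  assumes "tdef T" "tdef U" shows "bdef (\<lambda>e. T e = U e)"
proof -
  obtain t u \<tau> where "\<And>e. T e = eval M (inst \<tau> e) t" "\<And>e. U e = eval M (inst \<tau> e) u"
    using assms by (rule tdef_binary) (rule that)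
  moreover obtain E :: "nat \<Rightarrow> 'a set" where "range E \<subseteq> sets M" by (rule some_set)
  ultimately show ?thesis by (intro bdefI[where \<phi> = "Eq t u" and \<tau> = \<tau> and E = E] Delta00.intros) simp_all
qed

lemma bdef_less:
  assumes "tdef T" "tdef U" shows "bdef (\<lambda>e. T e \<prec> U e)"
proof -
  obtain t u \<tau> where "\<And>e. T e = eval M (inst \<tau> e) t" "\<And>e. U e = eval M (inst \<tau> e) u"
    using assms by (rule tdef_binary) (rule that)
  moreover obtain E :: "nat \<Rightarrow> 'a set" where "range E \<subseteq> sets M" by (rule some_set)
  ultimately show ?thesis by (intro bdefI[where \<phi> = "Less t u" and \<tau> = \<tau> and E = E] Delta00.intros) simp_all
qed

lemma bdef_mem:
  assumes "tdef T" "X \<in> sets M" shows "bdef (\<lambda>e. T e \<in> X)"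
proof -
  obtain t \<tau> where "\<And>e. T e = eval M (inst \<tau> e) t" using assms(1) by (rule tdefE) (rule that)
  then show ?thesis
    by (intro bdefI[where \<phi> = "Mem t 0" and \<tau> = \<tau> and E = "\<lambda>_. X"] Delta00.intros) (simp_all add: assms)
qed

lemma bdef_not:
  assumes "bdef P" shows "bdef (\<lambda>e. \<not> P e)"
proof -
  obtain \<phi> \<tau> E where 1: "\<phi> \<in> Delta00" "range E \<subseteq> sets M" "\<And>e. P e \<longleftrightarrow> sat M (inst \<tau> e) E \<phi>"
    using assms by (rule bdefE) (rule that)
  then show ?thesis
    by (intro bdefI[where \<phi> = "Neg \<phi>" and \<tau> = \<tau> and E = E] Delta00.intros) simp_all
qed

lemma bdef_conj:
  assumes "bdef P" "bdef Q" shows "bdef (\<lambda>e. P e \<and> Q e)"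
proof -
  obtain \<phi> \<psi> \<tau> E where "\<phi> \<in> Delta00" "\<psi> \<in> Delta00" "range E \<subseteq> sets M"
    "\<And>e. P e \<longleftrightarrow> sat M (inst \<tau> e) E \<phi>" "\<And>e. Q e \<longleftrightarrow> sat M (inst \<tau> e) E \<psi>"
    using assms by (rule bdef_binary) (rule that)
  then show ?thesis
    by (intro bdefI[where \<phi> = "Conj \<phi> \<psi>" and \<tau> = \<tau> and E = E] Delta00.intros) simp_all
qed

lemma bdef_disj:
  assumes "bdef P" "bdef Q" shows "bdef (\<lambda>e. P e \<or> Q e)"
proof -
  have "bdef (\<lambda>e. \<not> (\<not> P e \<and> \<not> Q e))" by (intro bdef_not bdef_conj assms)
  then show ?thesis by (simp only: de_Morgan_conj not_not)
qed

lemma bdef_imp: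
  assumes "bdef P" "bdef Q" shows "bdef (\<lambda>e. P e \<longrightarrow> Q e)"
  unfolding imp_conv_disj by (intro bdef_disj bdef_not assms)

lemma bdef_iff:
  assumes "bdef P" "bdef Q" shows "bdef (\<lambda>e. P e \<longleftrightarrow> Q e)"
  unfolding iff_conv_conj_imp by (intro bdef_conj bdef_imp assms)

lemma bdef_const: "bdef (\<lambda>e. b)"
proof -
  have "bdef (\<lambda>e. \<zero> = \<zero>)" by (intro bdef_eq tdef_const)
  moreover from this have "bdef (\<lambda>e. \<not> \<zero> = \<zero>)" by (rule bdef_not)
  ultimately show ?thesis by (cases b) (simp_all only: simp_thms)
qed

lemma bdef_bex:
  assumes "bdef (\<lambda>e. Q (\<lambda>n. e (Suc n)) (e 0))" "tdef T"
  shows "bdef (\<lambda>e. \<exists>a. a \<prec> T e \<and> Q e a)"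
proof -
  obtain \<phi> \<tau> E where 1: "\<phi> \<in> Delta00" "range E \<subseteq> sets M"
    "\<And>e. Q (\<lambda>n. e (Suc n)) (e 0) \<longleftrightarrow> sat M (inst \<tau> e) E \<phi>"
    using assms(1) by (rule bdefE) (rule that)
  obtain t \<tau>' where 2: "\<And>e. T e = eval M (inst \<tau>' e) t" using assms(2) by (rule tdefE) (rule that)
  \<comment> \<open>Variables that stand for component 0 all become the object variable 0, which the
    new quantifier binds. The others go to \<open>3 * n + 3\<close>, and those of the bounding term
    to \<open>3 * n + 1\<close>, away from 0.\<close>
  define f where "f n = (if \<tau> n = Inl 0 then 0 else 3 * n + 3)" for n
  define g :: "nat \<Rightarrow> nat" where "g n = 3 * n + 1" for n
  \<comment> \<open>Undoes both renamings; \<open>m - 1\<close> because components are shifted by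
    one under the quantifier.\<close>
  define \<sigma> where "\<sigma> n = (if n mod 3 = 1 then \<tau>' (n div 3)
     else (case \<tau> (n div 3 - 1) of Inl m \<Rightarrow> Inl (m - 1) | Inr c \<Rightarrow> Inr c))" for n
  have f: "(inst \<sigma> e)(0 := a) \<circ> f = inst \<tau> (case_nat a e)" for e a
    by (auto simp: fun_eq_iff f_def \<sigma>_def inst_def split: sum.splits nat.splits)
  have g: "(inst \<sigma> e)(0 := a) \<circ> g = inst \<tau>' e" for e a
    by (auto simp: fun_eq_iff g_def \<sigma>_def inst_def div3 split: sum.splits nat.splits)
  have "infinite (- range f)"
    by (rule infinite_co_range) (auto simp: f_def, presburger+)
  from Delta00_ren[OF 1(1) this, of M id]
  obtain \<phi>' where 3: "\<phi>' \<in> Delta00" "\<And>e E. sat M e E \<phi>' \<longleftrightarrow> sat M (e \<circ> f) E \<phi>" by auto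
  show ?thesis
  proof (rule bdefI)
    show "ExN 0 (Conj (Less (Var 0) (tm_ren g t)) \<phi>') \<in> Delta00"
      by (intro Delta00.intros 3) (auto simp: tm_vars_tm_ren g_def)
    fix e
    have "Q e a \<longleftrightarrow> sat M (inst \<tau> (case_nat a e)) E \<phi>" for a
      using 1(3)[of "case_nat a e"] by simp
    then show "(\<exists>a. a \<prec> T e \<and> Q e a) \<longleftrightarrow> sat M (inst \<sigma> e) E (ExN 0 (Conj (Less (Var 0) (tm_ren g t)) \<phi>'))"
      by (simp only: sat.simps eval.simps eval_tm_ren 3(2) f g fun_upd_same 2)
  qed (rule 1)
qed

lemma bdef_ball:
  assumes "bdef (\<lambda>e. Q (\<lambda>n. e (Suc n)) (e 0))" "tdef T"
  shows "bdef (\<lambda>e. \<forall>a. a \<prec> T e \<longrightarrow> Q e a)"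
proof -
  have "bdef (\<lambda>e. \<not> (\<exists>a. a \<prec> T e \<and> \<not> Q e a))" by (intro bdef_not bdef_bex assms)
  then show ?thesis by (simp only: not_ex de_Morgan_conj not_not imp_conv_disj)
qed

text \<open>One variable in the form in which the axiom schemes can be applied: variable 1 is the
  argument and variable 0 is a dummy for the unbounded quantifier in front.\<close>

lemma bdef_unary:
  assumes "bdef (\<lambda>e. P (e 0))"
  obtains \<phi> e E where "\<phi> \<in> Delta00" "range E \<subseteq> sets M"
    "\<And>a b. sat M (e(1 := a, 0 := b)) E \<phi> \<longleftrightarrow> P a"
proof -
  obtain \<phi> \<tau> E where 1: "\<phi> \<in> Delta00" "range E \<subseteq> sets M" "\<And>e. P (e 0) \<longleftrightarrow> sat M (inst \<tau> e) E \<phi>"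
    using assms(1) by (rule bdefE) (rule that)
  define f where "f n = (case \<tau> n of Inl _ \<Rightarrow> 1 | Inr _ \<Rightarrow> 3 * n + 3)" for n
  define e where "e n = (case \<tau> (n div 3 - 1) of Inl _ \<Rightarrow> undefined | Inr c \<Rightarrow> c)" for n
  have f: "e(1 := a, 0 := b) \<circ> f = inst \<tau> (\<lambda>_. a)" for a b
    by (auto simp: fun_eq_iff f_def e_def inst_def split: sum.splits)
  have "infinite (- range f)"
    by (rule infinite_co_range) (auto simp: f_def split: sum.splits, presburger+)
  from Delta00_ren[OF 1(1) this, of M id]
  obtain \<phi>' where 3: "\<phi>' \<in> Delta00" "\<And>e E. sat M e E \<phi>' \<longleftrightarrow> sat M (e \<circ> f) E \<phi>" by auto
  show thesis
    by (rule that[OF 3(1) 1(2), of e]) (simp only: 3(2) f 1(3)[symmetric])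
qed

text \<open>The matrix ignores the dummy variable, so its existential and universal closures agree;
  this is the equivalence that \<open>Delta01_comprehension\<close> asks for.\<close>

lemma bdef_comprehension:
  assumes "bdef (\<lambda>e. P (e 0))" shows "{a. P a} \<in> sets M"
proof -
  obtain \<phi> e E where 1: "\<phi> \<in> Delta00" "range E \<subseteq> sets M"
    "\<And>a b. sat M (e(1 := a, 0 := b)) E \<phi> \<longleftrightarrow> P a" using assms by (rule bdef_unary) (rule that)
  have "ExN 0 \<phi> \<in> Sigma01" "AllN 0 \<phi> \<in> Pi01" using 1(1) by (auto simp: Sigma01_def Pi01_def)
  moreover have "sat M (e(1 := a)) E (ExN 0 \<phi>) \<longleftrightarrow> P a" "sat M (e(1 := a)) E (AllN 0 \<phi>) \<longleftrightarrow> P a" for a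
    using 1(3)[of a] by simp_all
  ultimately have "\<exists>X\<in>sets M. \<forall>a. a \<in> X \<longleftrightarrow> P a"
    using rca0 1(2) unfolding RCA0_def Delta01_comprehension_def by metis
  then obtain X where "X \<in> sets M" "X = {a. P a}" by blast
  then show ?thesis by simp
qed

lemma bdef_induct:
  assumes "bdef (\<lambda>e. P (e 0))" "P \<zero>" "\<And>a. P a \<Longrightarrow> P (a \<oplus> \<one>)" shows "P a"
proof -
  obtain \<phi> e E where 1: "\<phi> \<in> Delta00" "range E \<subseteq> sets M"
    "\<And>a b. sat M (e(1 := a, 0 := b)) E \<phi> \<longleftrightarrow> P a" using assms(1) by (rule bdef_unary) (rule that)
  have S: "ExN 0 \<phi> \<in> Sigma01" using 1(1) by (auto simp: Sigma01_def)
  have P: "sat M (e(1 := a)) E (ExN 0 \<phi>) \<longleftrightarrow> P a" for a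
    using 1(3)[of a] by simp
  have "induction_scheme M Sigma01" using rca0 unfolding RCA0_def by blast
  from this[unfolded induction_scheme_def, rule_format, OF S 1(2), of e 1, unfolded P, OF assms(2,3)]
  show ?thesis by blast
qed

lemmas bdef_intros = bdef_const bdef_eq bdef_less bdef_mem bdef_not bdef_conj bdef_disj bdef_imp
  bdef_iff bdef_bex bdef_ball tdef_var tdef_const tdef_add tdef_mul tdef_pair

end

section \<open>Arithmetic in a model\<close>

context rca0
begin

lemma robinson: "robinson M"
  using rca0 unfolding RCA0_def by blast

lemma succ_ne_zero [simp]: "m \<oplus> \<one> \<noteq> \<zero>"
  and succ_inj [simp]: "m \<oplus> \<one> = n \<oplus> \<one> \<longleftrightarrow> m = n"
  and zero_or_succ: "m = \<zero> \<or> (\<exists>k. m = k \<oplus> \<one>)"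
  and add_zero [simp]: "m \<oplus> \<zero> = m"
  and add_succ: "m \<oplus> (n \<oplus> \<one>) = (m \<oplus> n) \<oplus> \<one>"
  and mul_zero [simp]: "m \<otimes> \<zero> = \<zero>"
  and mul_succ: "m \<otimes> (n \<oplus> \<one>) = (m \<otimes> n) \<oplus> m"
  and not_less_zero [simp]: "\<not> m \<prec> \<zero>"
  and less_succ: "m \<prec> n \<oplus> \<one> \<longleftrightarrow> m \<prec> n \<or> m = n"
  using robinson unfolding robinson_def by blast+

lemma zero_ne_succ [simp]: "\<zero> \<noteq> m \<oplus> \<one>"
  using succ_ne_zero by metis

lemma add_assoc: "(a \<oplus> b) \<oplus> c = a \<oplus> (b \<oplus> c)"
  by (rule bdef_induct[where a = c], (intro bdef_intros; fail)) (simp_all add: add_succ)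

lemma zero_add [simp]: "\<zero> \<oplus> a = a"
  by (rule bdef_induct[where a = a], (intro bdef_intros; fail)) (simp_all flip: add_assoc)

lemma zero_ne_one [simp]: "\<zero> \<noteq> \<one>" "\<one> \<noteq> \<zero>"
  using succ_ne_zero[of \<zero>] by auto

lemma one_add: "\<one> \<oplus> a = a \<oplus> \<one>"
  by (rule bdef_induct[where a = a], (intro bdef_intros; fail)) (simp_all flip: add_assoc)

lemma add_comm: "a \<oplus> b = b \<oplus> a"
proof (rule bdef_induct[where a = b])
  show "a \<oplus> (b \<oplus> \<one>) = (b \<oplus> \<one>) \<oplus> a" if "a \<oplus> b = b \<oplus> a" for b
    using that by (metis add_assoc one_add)
qed (intro bdef_intros, simp)

lemma add_left_comm: "a \<oplus> (b \<oplus> c) = b \<oplus> (a \<oplus> c)"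
  by (metis add_assoc add_comm)

lemmas add_ac = add_assoc add_comm add_left_comm

lemma add_right_cancel [simp]: "a \<oplus> c = b \<oplus> c \<longleftrightarrow> a = b"
  by (rule bdef_induct[where a = c], (intro bdef_intros; fail)) (simp_all flip: add_assoc)

lemma add_left_cancel [simp]: "c \<oplus> a = c \<oplus> b \<longleftrightarrow> a = b"
  by (simp add: add_comm[of c])

lemma add_mul: "(a \<oplus> b) \<otimes> c = a \<otimes> c \<oplus> b \<otimes> c"
  by (rule bdef_induct[where a = c], (intro bdef_intros; fail)) (simp_all add: mul_succ add_ac)

lemma mul_add: "a \<otimes> (b \<oplus> c) = a \<otimes> b \<oplus> a \<otimes> c"
  by (rule bdef_induct[where a = c], (intro bdef_intros; fail)) (simp_all add: mul_succ flip: add_assoc)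

lemma mul_one [simp]: "a \<otimes> \<one> = a"
  using mul_succ[of a \<zero>] by simp

lemma ne_add_succ: "a \<noteq> a \<oplus> (k \<oplus> \<one>)"
  using add_left_cancel[of a \<zero> "k \<oplus> \<one>"] by (metis add_zero zero_ne_succ)

lemma add_eq_zero: "a \<oplus> b = \<zero> \<Longrightarrow> b = \<zero>"
  using zero_or_succ[of b] by (metis add_succ succ_ne_zero)

lemma succ_less_succ: "x \<prec> y \<Longrightarrow> x \<oplus> \<one> \<prec> y \<oplus> \<one>"
proof -
  have "x \<prec> y \<longrightarrow> x \<oplus> \<one> \<prec> y \<oplus> \<one>"
    by (rule bdef_induct[where a = y], (intro bdef_intros; fail)) (auto simp: less_succ)
  then show "x \<prec> y \<Longrightarrow> x \<oplus> \<one> \<prec> y \<oplus> \<one>" by blast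
qed

lemma less_add_succ: "a \<prec> a \<oplus> (k \<oplus> \<one>)"
  by (rule bdef_induct[where a = k], (intro bdef_intros; fail))
    (simp_all add: less_succ flip: add_assoc)

lemma less_iff: "a \<prec> b \<longleftrightarrow> (\<exists>k. b = a \<oplus> (k \<oplus> \<one>))"
proof
  \<comment> \<open>The bound on \<open>k\<close> keeps the formula within reach of
    \<open>bdef_induct\<close>; it is dropped afterwards.\<close>
  have "a \<prec> b \<longrightarrow> (\<exists>k. k \<prec> b \<oplus> \<one> \<and> b = a \<oplus> (k \<oplus> \<one>))"
  proof (rule bdef_induct[where a = b])
    fix b assume IH: "a \<prec> b \<longrightarrow> (\<exists>k. k \<prec> b \<oplus> \<one> \<and> b = a \<oplus> (k \<oplus> \<one>))"
    show "a \<prec> b \<oplus> \<one> \<longrightarrow> (\<exists>k. k \<prec> b \<oplus> \<one> \<oplus> \<one> \<and> b \<oplus> \<one> = a \<oplus> (k \<oplus> \<one>))"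
    proof
      assume "a \<prec> b \<oplus> \<one>"
      then consider "a \<prec> b" | "a = b" by (auto simp: less_succ)
      then show "\<exists>k. k \<prec> b \<oplus> \<one> \<oplus> \<one> \<and> b \<oplus> \<one> = a \<oplus> (k \<oplus> \<one>)"
      proof cases
        case 1
        with IH obtain k where k: "k \<prec> b \<oplus> \<one>" "b = a \<oplus> (k \<oplus> \<one>)" by blast
        then have "b \<oplus> \<one> = a \<oplus> (k \<oplus> \<one> \<oplus> \<one>)" by (simp add: add_assoc)
        then show ?thesis using succ_less_succ[OF k(1)] by blast
      next
        case 2
        then show ?thesis using less_add_succ[of \<zero> "b \<oplus> \<one>"] by (intro exI[of _ \<zero>]) simp
      qed
    qed
  qed (intro bdef_intros, simp)
  then show "a \<prec> b \<Longrightarrow> \<exists>k. b = a \<oplus> (k \<oplus> \<one>)" by blast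
qed (use less_add_succ in auto)

lemma less_irrefl [simp]: "\<not> a \<prec> a"
  using less_iff ne_add_succ by blast

lemma zero_less_succ [simp]: "\<zero> \<prec> a \<oplus> \<one>"
  using less_iff by auto

lemma less_self_succ [simp]: "a \<prec> a \<oplus> \<one>"
  by (simp add: less_succ)

lemma trichotomy: "a \<prec> b \<or> a = b \<or> b \<prec> a"
proof (rule bdef_induct[where a = b])
  show "a \<prec> \<zero> \<or> a = \<zero> \<or> \<zero> \<prec> a"
    using zero_or_succ[of a] by auto
  fix b assume "a \<prec> b \<or> a = b \<or> b \<prec> a"
  then consider "a \<prec> b \<or> a = b" | k where "a = b \<oplus> (k \<oplus> \<one>)" using less_iff by blast
  then show "a \<prec> b \<oplus> \<one> \<or> a = b \<oplus> \<one> \<or> b \<oplus> \<one> \<prec> a"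
  proof cases
    case 1 then show ?thesis by (auto simp: less_succ)
  next
    case 2
    then have "a = b \<oplus> \<one> \<or> (\<exists>j. a = b \<oplus> \<one> \<oplus> (j \<oplus> \<one>))"
      using zero_or_succ[of k] by (auto simp: add_ac)
    then show ?thesis using less_iff by blast
  qed
qed (intro bdef_intros)

section \<open>The pairing function: bounds and injectivity\<close>

lemma pairN_bounds: "a \<prec> pairN M a b \<oplus> \<one>" "b \<prec> pairN M a b \<oplus> \<one>"
proof -
  show "a \<prec> pairN M a b \<oplus> \<one>"
    unfolding less_iff pairN_def by (intro exI[of _ "(a \<oplus> b) \<otimes> (a \<oplus> b)"]) (simp add: add_ac)
  have "\<exists>k. pairN M a b = k \<oplus> b"
  proof (cases "a \<oplus> b = \<zero>")
    case True
    then show ?thesis using add_eq_zero by (metis add_zero)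
  next
    case False
    then obtain t where "a \<oplus> b = t \<oplus> \<one>" using zero_or_succ by blast
    then have "pairN M a b = (a \<oplus> b) \<otimes> t \<oplus> (a \<oplus> b) \<oplus> a" unfolding pairN_def
      by (metis mul_succ)
    then show ?thesis by (metis add_assoc add_comm)
  qed
  then show "b \<prec> pairN M a b \<oplus> \<one>"
    unfolding less_iff by (metis add_assoc add_comm)
qed

text \<open>Squares grow faster than the added summand: if \<open>s\<close> exceeds
  \<open>a + b\<close>, then \<open>s * s\<close> exceeds the square of \<open>a + b\<close> by more
  than \<open>a + b\<close>, hence by more than \<open>a\<close>. The calculation exhibits the
  difference as a successor.\<close>

lemma pairN_less:
  assumes "a \<oplus> b \<prec> s" shows "(a \<oplus> b) \<otimes> (a \<oplus> b) \<oplus> a \<noteq> s \<otimes> s \<oplus> c"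
proof -
  obtain k where k: "s = (a \<oplus> b) \<oplus> (k \<oplus> \<one>)" using assms less_iff by blast
  let ?s = "a \<oplus> b" and ?t = "k \<oplus> \<one>"
  have 1: "s \<otimes> s = ?s \<otimes> ?s \<oplus> ?t \<otimes> ?s \<oplus> (s \<otimes> k \<oplus> (?s \<oplus> (k \<oplus> \<one>)))"
    unfolding k by (simp add: mul_add add_mul add_ac)
  have 2: "s \<otimes> s \<oplus> c = (?s \<otimes> ?s \<oplus> a) \<oplus> ((?t \<otimes> ?s \<oplus> s \<otimes> k \<oplus> b \<oplus> k \<oplus> c) \<oplus> \<one>)"
    unfolding 1 by (simp only: add_ac)
  show ?thesis unfolding 2 by (rule ne_add_succ)
qed

lemma pairN_inject [simp]: "pairN M a b = pairN M c d \<longleftrightarrow> a = c \<and> b = d"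
proof
  assume eq: "pairN M a b = pairN M c d"
  have "a \<oplus> b = c \<oplus> d"
  proof -
    have "\<not> a \<oplus> b \<prec> c \<oplus> d" using pairN_less[of a b "c \<oplus> d" c] eq unfolding pairN_def by blast
    moreover have "\<not> c \<oplus> d \<prec> a \<oplus> b"
      using pairN_less[of c d "a \<oplus> b" a] eq[symmetric] unfolding pairN_def by blast
    ultimately show ?thesis using trichotomy by blast
  qed
  then show "a = c \<and> b = d" using eq unfolding pairN_def by auto
qed simp

lemma bdef_bounded_ex:
  assumes "bdef (\<lambda>e. Q (\<lambda>n. e (Suc n)) (e 0))" "tdef T" "\<And>e a. Q e a \<Longrightarrow> a \<prec> T e \<oplus> \<one>"
  shows "bdef (\<lambda>e. \<exists>a. Q e a)"
proof -
  have "(\<exists>a. Q e a) \<longleftrightarrow> (\<exists>a. a \<prec> T e \<oplus> \<one> \<and> Q e a)" for e using assms(3) by blast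
  moreover have "bdef (\<lambda>e. \<exists>a. a \<prec> T e \<oplus> \<one> \<and> Q e a)"
    by (intro bdef_bex assms bdef_intros)
  ultimately show ?thesis by (simp only:)
qed

text \<open>No syntactic substitution is performed: the value of \<open>T\<close> is introduced by a
  quantifier that \<open>T\<close> itself bounds.\<close>

lemma bdef_subst:
  assumes "bdef (\<lambda>e. Q (\<lambda>n. e (Suc n)) (e 0))" "tdef T"
  shows "bdef (\<lambda>e. Q e (T e))"
proof -
  have "bdef (\<lambda>e. \<exists>a. a \<prec> T e \<oplus> \<one> \<and> (a = T e \<and> Q e a))"
    by (intro bdef_intros assms tdef_ren[of T])
  then show ?thesis by simp
qed

text \<open>Quantifiers over the components of a pair are bounded by the code of the pair.\<close>

lemma bdef_ex_pair:
  assumes "bdef (\<lambda>e. Q (\<lambda>n. e (Suc (Suc n))) (e 0) (e 1))" "tdef T"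
  shows "bdef (\<lambda>e. \<exists>a b. T e = pairN M a b \<and> Q e a b)"
proof -
  have "bdef (\<lambda>e. \<exists>b. b \<prec> T e \<oplus> \<one> \<and> (\<exists>a. a \<prec> T e \<oplus> \<one> \<and> (T e = pairN M a b \<and> Q e a b)))"
    using assms(1) by (intro bdef_intros assms(2) tdef_ren[of T] tdef_ren[of "\<lambda>e. T (\<lambda>n. e (Suc n))"]) simp_all
  moreover have "(\<exists>a b. T e = pairN M a b \<and> Q e a b) \<longleftrightarrow>
    (\<exists>b. b \<prec> T e \<oplus> \<one> \<and> (\<exists>a. a \<prec> T e \<oplus> \<one> \<and> (T e = pairN M a b \<and> Q e a b)))" for e
  proof
    assume "\<exists>a b. T e = pairN M a b \<and> Q e a b"
    then obtain a b where "T e = pairN M a b" "Q e a b" by blast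
    then show "\<exists>b. b \<prec> T e \<oplus> \<one> \<and> (\<exists>a. a \<prec> T e \<oplus> \<one> \<and> (T e = pairN M a b \<and> Q e a b))"
      using pairN_bounds(1)[of a b] pairN_bounds(2)[of b a] by auto
  qed blast
  ultimately show ?thesis by (simp only:)
qed

end

section \<open>Infinite paths from the extension lemma\<close>

context rca0
begin

section \<open>Functions coded by definable graphs\<close>

lemma bdef_subst2:
  assumes "bdef (\<lambda>e. R (e 0) (e 1))" "tdef T" "tdef U"
  shows "bdef (\<lambda>e. R (T e) (U e))"
proof -
  \<comment> \<open>Truncated subtraction \<open>1 - n\<close> swaps components 0 and 1.\<close>
  have "bdef (\<lambda>e. R (e 1) (e 0))"
    using bdef_ren[OF assms(1), of "\<lambda>n. 1 - n"] by simp
  then have "bdef (\<lambda>e. R (e 0) (U (\<lambda>n. e (Suc n))))"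
    by (intro bdef_subst[where Q = "\<lambda>e b. R (e 0) b"] tdef_ren[OF assms(3)]) simp
  then show ?thesis by (intro bdef_subst[where Q = "\<lambda>e a. R a (U e)"] assms(2))
qed

abbreviation fn :: "'a set \<Rightarrow> bool" where
  "fn F \<equiv> is_function M F UNIV UNIV"

lemma app_eq_iff: "is_function M F A B \<Longrightarrow> a \<in> A \<Longrightarrow> app M F a = b \<longleftrightarrow> pairN M a b \<in> F"
  unfolding is_function_def app_def by (metis the_equality)

lemma bdef_app: "fn F \<Longrightarrow> tdef T \<Longrightarrow> tdef U \<Longrightarrow> bdef (\<lambda>e. app M F (T e) = U e)"
proof -
  assume F: "fn F" and T: "tdef T" and U: "tdef U"
  have "F \<in> sets M" using F unfolding is_function_def by blast
  then have "bdef (\<lambda>e. pairN M (T e) (U e) \<in> F)" by (intro bdef_mem tdef_pair T U)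
  then show ?thesis by (simp only: app_eq_iff[OF F UNIV_I])
qed

lemma fn_from_graph:
  assumes "bdef (\<lambda>e. G (e 0) (e 1))" "\<And>i. \<exists>!x. G i x"
  obtains F where "fn F" "\<And>i x. app M F i = x \<longleftrightarrow> G i x"
proof -
  let ?F = "{n. \<exists>i x. n = pairN M i x \<and> G i x}"
  have F: "?F \<in> sets M" "?F \<subseteq> prodN M UNIV UNIV"
    by (intro bdef_comprehension bdef_ex_pair bdef_subst2[OF assms(1)] tdef_var) (auto simp: prodN_def)
  have pair: "pairN M i x \<in> ?F \<longleftrightarrow> G i x" for i x by simp
  have "fn ?F"
    unfolding is_function_def pair by (intro conjI ballI F assms(2))
  then show thesis
    by (rule that) (simp only: app_eq_iff[OF \<open>fn ?F\<close> UNIV_I] pair)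
qed

end

locale rca0_ctl = rca0 +
  assumes extension: "restricted_valuation_extension_CTL M"
begin

lemma EG_PVar_in_Fml: "EG M (PVar M k) \<in> Fml_upto M \<one>"
proof -
  let ?p = "PVar M k"
  let ?D = "{n. n = pairN M ?p \<zero> \<or> n = pairN M (EG M ?p) \<one>}"
  have D: "?D \<in> sets M" by (intro bdef_comprehension bdef_intros)
  have clauses: "degree_clauses M ?D \<psi> i" if "pairN M \<psi> i \<in> ?D" for \<psi> i
  proof (cases "\<psi> = ?p \<and> i = \<zero>")
    case True
    then show ?thesis by (simp add: degree_clauses_def Props_def)
  next
    case False
    then have "\<psi> = EG M ?p \<and> pairN M ?p \<zero> \<in> ?D \<and> i = \<one> \<oplus> \<zero>" using that by auto
    then show ?thesis unfolding degree_clauses_def by blast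
  qed
  have "has_degree M (EG M ?p) \<one>"
    unfolding has_degree_def by (rule bexI[OF _ D]) (intro conjI allI impI clauses; simp)
  then show ?thesis unfolding Fml_upto_def leN_def by blast
qed

text \<open>The frame consists of the graph on the positive numbers, shifted by one, and a sink 0 that
  makes it serial; the variable \<open>p\<close> holds outside the sink, so \<open>EG p\<close> says that there is an
  infinite path in the graph.\<close>

lemma path_set:
  assumes R: "bdef (\<lambda>e. R (e 0) (e 1))"
  obtains S where "S \<in> sets M"
    "\<And>w. w \<in> S \<longleftrightarrow> (\<exists>f. fn f \<and> app M f \<zero> = w \<and> (\<forall>i. R (app M f i) (app M f (i \<oplus> \<one>))))"
proof -
  \<comment> \<open>Every point, 0 included, has an edge to 0; the remaining edges are the shifted
    ones of \<open>R\<close>. A path that avoids 0 is therefore a shifted path of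
    \<open>R\<close>.\<close>
  let ?R = "{n. \<exists>w u. n = pairN M w u \<and> (u = \<zero> \<or> (\<exists>w'. w = w' \<oplus> \<one> \<and> (\<exists>u'. u = u' \<oplus> \<one> \<and> R w' u')))}"
  \<comment> \<open>All propositional variables get the same value, 0 at the sink and 1 elsewhere;
    \<open>numeralN M 1\<close> is the tag of \<open>PVar\<close>.\<close>
  let ?v = "{n. \<exists>x b. n = pairN M x b \<and> (\<exists>w p. x = pairN M w p \<and> (\<exists>c k. p = pairN M c k \<and>
    (c = numeralN M 1 \<and> (w = \<zero> \<and> b = \<zero> \<or> w \<noteq> \<zero> \<and> b = \<one>))))}"
  have U: "(UNIV :: 'a set) \<in> sets M" using bdef_comprehension[of "\<lambda>_. True"] by (simp add: bdef_const)
  have 1: "bdef (\<lambda>e. \<exists>u'. e 1 = u' \<oplus> \<one> \<and> R (e 0) u')"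
    by (intro bdef_bounded_ex[where T = "\<lambda>e. e 1"] bdef_conj bdef_subst2[OF R] bdef_eq
        tdef_add tdef_const tdef_var) (auto simp: less_succ)
  have 2: "bdef (\<lambda>e. \<exists>w'. e 0 = w' \<oplus> \<one> \<and> (\<exists>u'. e 1 = u' \<oplus> \<one> \<and> R w' u'))"
    by (intro bdef_subst2[of "\<lambda>w u. \<exists>u'. u = u' \<oplus> \<one> \<and> R w u'", OF 1]
        bdef_bounded_ex[where T = "\<lambda>e. e 0"] bdef_conj bdef_eq tdef_add tdef_const tdef_var)
      (auto simp: less_succ)
  have "?R \<in> sets M"
    by (intro bdef_comprehension bdef_ex_pair bdef_disj 2 bdef_eq tdef_var tdef_const)
  have "?v \<in> sets M"
    by (intro bdef_comprehension bdef_ex_pair bdef_intros)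
  have fr: "frame M UNIV ?R" "serial M UNIV ?R"
    using U \<open>?R \<in> sets M\<close> by (auto simp: frame_def serial_def prodN_def)
  have in_v: "pairN M (pairN M w (PVar M k)) b \<in> ?v \<longleftrightarrow> b = (if w = \<zero> then \<zero> else \<one>)" for w k b
    by (auto simp: PVar_def)
  have v: "is_function M ?v (prodN M UNIV (Props M)) {\<zero>, \<one>}"
    unfolding is_function_def
  proof (intro conjI ballI \<open>?v \<in> sets M\<close>)
    show "?v \<subseteq> prodN M (prodN M UNIV (Props M)) {\<zero>, \<one>}"
      unfolding prodN_def Props_def PVar_def by auto
    fix x assume "x \<in> prodN M UNIV (Props M)"
    then obtain w k where "x = pairN M w (PVar M k)" unfolding prodN_def Props_def by auto
    then show "\<exists>!b. pairN M x b \<in> ?v" by (simp only: in_v) simp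
  qed
  note extension[unfolded restricted_valuation_extension_CTL_def, THEN spec, THEN spec, THEN spec, THEN spec,
      THEN mp, OF conjI[OF fr(1) conjI[OF fr(2) v]], of \<one>]
  then obtain V where V: "restricted_valuation M UNIV ?R \<one> V"
    and ext: "\<forall>w\<in>UNIV. \<forall>p\<in>Props M. val M V w p = val M ?v w p" by (elim exE conjE) (rule that)
  let ?p = "PVar M \<zero>"
  let ?S = "{w. pairN M (pairN M (w \<oplus> \<one>) (EG M ?p)) \<one> \<in> V}"
  have Vf: "is_function M V (prodN M UNIV (Fml_upto M \<one>)) {\<zero>, \<one>}"
    using V unfolding restricted_valuation_def by blast
  have p: "val M V w ?p = \<one> \<longleftrightarrow> w \<noteq> \<zero>" for w
  proof -
    have "?p \<in> Props M" by (simp add: Props_def)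
    then have "val M V w ?p = val M ?v w ?p" using ext by blast
    moreover have "val M ?v w ?p = \<one> \<longleftrightarrow> pairN M (pairN M w ?p) \<one> \<in> ?v"
      using \<open>?p \<in> Props M\<close> by (intro app_eq_iff[OF v]) (auto simp: prodN_def)
    ultimately show ?thesis by (simp only: in_v) simp
  qed
  have S: "w \<in> ?S \<longleftrightarrow> (\<exists>f. is_path M UNIV ?R (w \<oplus> \<one>) f \<and> (\<forall>i. app M f i \<noteq> \<zero>))" for w
  proof -
    have "w \<in> ?S \<longleftrightarrow> val M V (w \<oplus> \<one>) (EG M ?p) = \<one>"
      using EG_PVar_in_Fml by (subst app_eq_iff[OF Vf]) (auto simp: prodN_def)
    also have "\<dots> \<longleftrightarrow> (\<exists>f. is_path M UNIV ?R (w \<oplus> \<one>) f \<and> (\<forall>i. val M V (app M f i) ?p = \<one>))"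
      by (rule V[unfolded restricted_valuation_def, THEN conjunct2, THEN bspec, OF UNIV_I, THEN conjunct2,
          THEN conjunct2, THEN conjunct2, THEN conjunct1, THEN spec, THEN mp, OF EG_PVar_in_Fml])
    finally show ?thesis unfolding p .
  qed
  show thesis
  proof (rule that)
    show "?S \<in> sets M"
      using Vf by (intro bdef_comprehension bdef_intros) (simp add: is_function_def)
    show "w \<in> ?S \<longleftrightarrow> (\<exists>f. fn f \<and> app M f \<zero> = w \<and> (\<forall>i. R (app M f i) (app M f (i \<oplus> \<one>))))" for w
      unfolding S
    proof (intro iffI; elim exE conjE)
      fix f assume f: "is_path M UNIV ?R (w \<oplus> \<one>) f" and pos: "\<forall>i. app M f i \<noteq> \<zero>"
      then have "fn f" by (simp add: is_path_def)
      have "bdef (\<lambda>e. app M f (e 0) = e 1 \<oplus> \<one>)" by (intro bdef_app \<open>fn f\<close> bdef_intros)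
      moreover have "\<exists>!x. app M f i = x \<oplus> \<one>" for i using pos zero_or_succ[of "app M f i"] by auto
      ultimately obtain g where g: "fn g" "\<And>i x. app M g i = x \<longleftrightarrow> app M f i = x \<oplus> \<one>"
        by (rule fn_from_graph[of "\<lambda>i x. app M f i = x \<oplus> \<one>"]) (rule that)
      then have fg: "app M f i = app M g i \<oplus> \<one>" for i by blast
      have "R (app M g i) (app M g (i \<oplus> \<one>))" for i
        using f unfolding is_path_def fg by auto
      moreover have "app M g \<zero> = w" using f unfolding g(2) is_path_def by blast
      ultimately show "\<exists>f. fn f \<and> app M f \<zero> = w \<and> (\<forall>i. R (app M f i) (app M f (i \<oplus> \<one>)))"
        using \<open>fn g\<close> by blast
    next
      fix g assume g: "fn g" "app M g \<zero> = w" "\<forall>i. R (app M g i) (app M g (i \<oplus> \<one>))"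
      have "bdef (\<lambda>e. \<exists>y. e 1 = y \<oplus> \<one> \<and> app M g (e 0) = y)"
        by (intro bdef_bounded_ex[where T = "\<lambda>e. e 1"] bdef_app g(1) bdef_intros) (auto simp: less_succ)
      then obtain f where f: "fn f" "\<And>i x. app M f i = x \<longleftrightarrow> (\<exists>y. x = y \<oplus> \<one> \<and> app M g i = y)"
        by (rule fn_from_graph[of "\<lambda>i x. \<exists>y. x = y \<oplus> \<one> \<and> app M g i = y"]) (simp, rule that)
      then have fg: "app M f i = app M g i \<oplus> \<one>" for i by blast
      have "is_path M UNIV ?R (w \<oplus> \<one>) f" using f(1) g unfolding is_path_def fg by auto
      then show "\<exists>f. is_path M UNIV ?R (w \<oplus> \<one>) f \<and> (\<forall>i. app M f i \<noteq> \<zero>)"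
        using fg by auto
    qed
  qed
qed

text \<open>Dropping the first point of a path and prepending a new one give the two directions of
  the equation; a loop carries a constant path.\<close>

lemma path_fixpoint:
  assumes R: "bdef (\<lambda>e. R (e 0) (e 1))"
  obtains S where "S \<in> sets M" "\<And>w. w \<in> S \<longleftrightarrow> (\<exists>u. R w u \<and> u \<in> S)" "\<And>w. R w w \<Longrightarrow> w \<in> S"
proof -
  obtain S where S: "S \<in> sets M"
    "\<And>w. w \<in> S \<longleftrightarrow> (\<exists>f. fn f \<and> app M f \<zero> = w \<and> (\<forall>i. R (app M f i) (app M f (i \<oplus> \<one>))))"
    using R by (rule path_set) (rule that)
  show thesis
  proof (rule that[OF S(1)])
    fix w
    show "w \<in> S \<longleftrightarrow> (\<exists>u. R w u \<and> u \<in> S)"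
    proof
      assume "w \<in> S"
      then obtain f where f: "fn f" "app M f \<zero> = w" "\<forall>i. R (app M f i) (app M f (i \<oplus> \<one>))"
        unfolding S(2) by blast
      have "bdef (\<lambda>e. app M f (e 0 \<oplus> \<one>) = e 1)" by (intro bdef_app f bdef_intros)
      then obtain g where g: "fn g" "\<And>i x. app M g i = x \<longleftrightarrow> app M f (i \<oplus> \<one>) = x"
        by (rule fn_from_graph[of "\<lambda>i x. app M f (i \<oplus> \<one>) = x"]) (simp, rule that)
      then have fg: "app M g i = app M f (i \<oplus> \<one>)" for i by blast
      have "app M g \<zero> \<in> S" unfolding S(2) using g(1) fg f(3) by auto
      moreover have "R w (app M g \<zero>)" using f(2) f(3)[rule_format, of \<zero>] fg[of \<zero>] by simp
      ultimately show "\<exists>u. R w u \<and> u \<in> S" by blast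
    next
      assume "\<exists>u. R w u \<and> u \<in> S"
      then obtain f where f: "fn f" "R w (app M f \<zero>)" "\<forall>i. R (app M f i) (app M f (i \<oplus> \<one>))"
        unfolding S(2) by blast
      let ?G = "\<lambda>i x. i = \<zero> \<and> x = w \<or> (\<exists>j. i = j \<oplus> \<one> \<and> app M f j = x)"
      have "bdef (\<lambda>e. ?G (e 0) (e 1))"
        by (intro bdef_disj bdef_conj bdef_bounded_ex[where T = "\<lambda>e. e 0"] bdef_app f bdef_intros)
          (auto simp: less_succ)
      moreover have "\<exists>!x. ?G i x" for i using zero_or_succ[of i] by auto
      ultimately obtain g where g: "fn g" "\<And>i x. app M g i = x \<longleftrightarrow> ?G i x"
        by (rule fn_from_graph[of ?G]) (rule that)
      then have 0: "app M g \<zero> = w" "\<And>i. app M g (i \<oplus> \<one>) = app M f i" by auto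
      have "R (app M g i) (app M g (i \<oplus> \<one>))" for i
        using zero_or_succ[of i] 0 f(2,3) by auto
      then show "w \<in> S" unfolding S(2) using g(1) 0 by blast
    qed
  next
    fix w assume "R w w"
    have "bdef (\<lambda>e. e 1 = w)" by (intro bdef_intros)
    then obtain g where g: "fn g" "\<And>i x. app M g i = x \<longleftrightarrow> x = w"
      by (rule fn_from_graph[of "\<lambda>i x. x = w"]) (simp, rule that)
    then have "app M g i = w" for i by blast
    then show "w \<in> S" unfolding S(2) using g(1) \<open>R w w\<close> by auto
  qed
qed

text \<open>From the start \<open>(x, 0)\<close> a path can only jump to \<open>(x, y + 1)\<close>
  with \<open>Q x y\<close>, where it loops. The witness is part of the target point, so the edge
  relation is bounded although the choice of the target is not; the successor keeps targets apart
  from starts.\<close>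

lemma sigma1_comprehension:
  assumes Q: "bdef (\<lambda>e. Q (e 0) (e 1))" shows "{x. \<exists>y. Q x y} \<in> sets M"
proof -
  let ?R = "\<lambda>w u. \<exists>x z. u = pairN M x z \<and> (\<exists>y. z = y \<oplus> \<one> \<and> (Q x y \<and> (w = pairN M x \<zero> \<or> w = u)))"
  have "bdef (\<lambda>e. ?R (e 0) (e 1))"
    by (intro bdef_ex_pair bdef_bounded_ex[where T = "\<lambda>e. e 1"] bdef_conj bdef_disj bdef_subst2[OF Q] bdef_intros)
      (auto simp: less_succ)
  then obtain S where S: "S \<in> sets M" "\<And>w. w \<in> S \<longleftrightarrow> (\<exists>u. ?R w u \<and> u \<in> S)" "\<And>w. ?R w w \<Longrightarrow> w \<in> S"
    by (rule path_fixpoint[of ?R]) (rule that)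
  have "pairN M x \<zero> \<in> S \<longleftrightarrow> (\<exists>y. Q x y)" for x
    using S(2)[of "pairN M x \<zero>"] S(3)[of "pairN M x (_ \<oplus> \<one>)"] by auto
  moreover have "{x. pairN M x \<zero> \<in> S} \<in> sets M" by (intro bdef_comprehension bdef_intros S(1))
  ultimately show ?thesis by simp
qed

end

section \<open>Arithmetical comprehension\<close>

context rca0
begin

text \<open>The length is a standard number, so the code is an iterated pair, given by a term, and
  no recursion inside the model is involved.\<close>

primrec enc :: "nat \<Rightarrow> (nat \<Rightarrow> 'a) \<Rightarrow> 'a" where
  "enc 0 s = \<zero>"
| "enc (Suc k) s = pairN M (enc k s) (s k)"

lemma enc_eq_iff: "enc k s = enc k s' \<longleftrightarrow> (\<forall>n<k. s n = s' n)"
  by (induction k) (auto simp: less_Suc_eq)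

lemma tdef_enc: "(\<And>n. tdef (\<lambda>e. T e n)) \<Longrightarrow> tdef (\<lambda>e. enc k (T e))"
proof (induction k)
  case 0
  show ?case by (simp only: enc.simps tdef_const)
next
  case (Suc k)
  show ?case unfolding enc.simps by (intro tdef_pair Suc)
qed

lemma bdef_finite_support:
  assumes "bdef P"
  shows "\<exists>K. \<forall>e e'. (\<forall>n<K. e n = e' n) \<longrightarrow> (P e \<longleftrightarrow> P e')"
proof -
  obtain \<phi> \<tau> E where P: "\<And>e. P e \<longleftrightarrow> sat M (inst \<tau> e) E \<phi>"
    using assms by (rule bdefE) (rule that)
  let ?A = "(\<lambda>x. case \<tau> x of Inl m \<Rightarrow> m | Inr _ \<Rightarrow> 0) ` fm_vars \<phi>"
  have "finite ?A" by (simp add: finite_fm_vars)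
  then obtain K where K: "\<forall>m\<in>?A. m < K" by (auto simp: finite_nat_set_iff_bounded)
  show ?thesis
  proof (intro exI allI impI)
    fix e e' :: "nat \<Rightarrow> 'a" assume eq: "\<forall>n<K. e n = e' n"
    show "P e \<longleftrightarrow> P e'"
      unfolding P
    proof (rule sat_cong)
      fix x assume "x \<in> fm_vars \<phi>"
      then have "(case \<tau> x of Inl m \<Rightarrow> m | Inr _ \<Rightarrow> 0) < K" using K by blast
      then show "inst \<tau> e x = inst \<tau> e' x"
        unfolding inst_def by (cases "\<tau> x") (simp_all add: eq)
    qed
  qed
qed

text \<open>Unpacking an iterated pair of standard length takes only bounded quantifiers. This lets
  a condition on many components be treated as one on a single code, as the binary
  \<open>sigma1_comprehension\<close> requires.\<close>

lemma bdef_decode: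
  assumes "bdef P"
  shows "bdef (\<lambda>e. \<exists>s. enc k s = e 0 \<and> P (\<lambda>n. if n < k then s n else e (Suc (n - k))))"
proof (induction k)
  case 0
  have "bdef (\<lambda>e. \<zero> = e 0 \<and> P (\<lambda>n. e (Suc n)))"
    by (intro bdef_conj bdef_ren[OF assms] bdef_intros)
  then show ?case by simp
next
  case (Suc k)
  let ?D = "\<lambda>e. \<exists>s. enc k s = e 0 \<and> P (\<lambda>n. if n < k then s n else e (Suc (n - k)))"
  let ?Q = "\<lambda>e d v. \<exists>s. enc k s = d \<and> P (\<lambda>n. if n < k then s n else if n = k then v else e (Suc (n - Suc k)))"
  \<comment> \<open>Component 2 is the code that is being split; the renaming skips it.\<close>
  have "?Q (\<lambda>n. e (Suc (Suc n))) (e 0) (e 1) \<longleftrightarrow> ?D (\<lambda>n. e (if n < 2 then n else Suc n))" for e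
  proof -
    have "(\<lambda>n. if n < k then s n else if n = k then e 1 else e (Suc (Suc (Suc (n - Suc k))))) =
      (\<lambda>n. if n < k then s n else e (if Suc (n - k) < 2 then Suc (n - k) else Suc (Suc (n - k))))" for s
      by (auto simp: fun_eq_iff Suc_diff_Suc)
    then show ?thesis by simp
  qed
  then have "bdef (\<lambda>e. ?Q (\<lambda>n. e (Suc (Suc n))) (e 0) (e 1))"
    using bdef_ren[OF Suc.IH, of "\<lambda>n. if n < 2 then n else Suc n"] by (simp only:)
  then have "bdef (\<lambda>e. \<exists>d v. e 0 = pairN M d v \<and> ?Q e d v)"
    by (rule bdef_ex_pair[where Q = ?Q]) (rule tdef_var)
  moreover have "(\<exists>d v. e 0 = pairN M d v \<and> ?Q e d v) \<longleftrightarrow>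
    (\<exists>s. enc (Suc k) s = e 0 \<and> P (\<lambda>n. if n < Suc k then s n else e (Suc (n - Suc k))))" (is "?l \<longleftrightarrow> ?r") for e
  proof
    assume ?l
    then obtain v s where s: "e 0 = pairN M (enc k s) v"
      "P (\<lambda>n. if n < k then s n else if n = k then v else e (Suc (n - Suc k)))" by blast
    have "(\<lambda>n. if n < k then s n else if n = k then v else e (Suc (n - Suc k))) =
      (\<lambda>n. if n < Suc k then (s(k := v)) n else e (Suc (n - Suc k)))" by (auto simp: fun_eq_iff)
    moreover have "enc k (s(k := v)) = enc k s" by (simp add: enc_eq_iff)
    ultimately show ?r using s by (intro exI[of _ "s(k := v)"]) simp
  next
    assume ?r
    then obtain s where s: "enc (Suc k) s = e 0" "P (\<lambda>n. if n < Suc k then s n else e (Suc (n - Suc k)))" by blast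
    have "(\<lambda>n. if n < k then s n else if n = k then s k else e (Suc (n - Suc k))) =
      (\<lambda>n. if n < Suc k then s n else e (Suc (n - Suc k)))" by (auto simp: fun_eq_iff less_Suc_eq)
    then show ?l using s by (intro exI[of _ "enc k s"] exI[of _ "s k"] conjI exI[of _ s]) simp_all
  qed
  ultimately show ?case by (simp only:)
qed

lemma least_element:
  assumes "bdef (\<lambda>e. P (e 0))" "P a"
  obtains m where "P m" "\<And>k. k \<prec> m \<Longrightarrow> \<not> P k"
proof (rule ccontr)
  assume *: "\<not> thesis"
  have "\<forall>k. k \<prec> b \<longrightarrow> \<not> P k" for b
  proof (rule bdef_induct[where a = b])
    show "bdef (\<lambda>e. \<forall>k. k \<prec> e 0 \<longrightarrow> \<not> P k)"
      by (intro bdef_ball bdef_not bdef_ren[OF assms(1), of "\<lambda>n. n"] tdef_var)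
    show "\<forall>k. k \<prec> \<zero> \<longrightarrow> \<not> P k" by simp
    fix b assume b: "\<forall>k. k \<prec> b \<longrightarrow> \<not> P k"
    then have "\<not> P b" using * that by blast
    with b show "\<forall>k. k \<prec> b \<oplus> \<one> \<longrightarrow> \<not> P k" by (auto simp: less_succ)
  qed
  from this[of "a \<oplus> \<one>"] assms(2) show False by simp
qed

text \<open>The least value is chosen: minimality adds only a bounded quantifier, so the graph stays
  definable.\<close>

lemma uniformization:
  assumes G: "bdef (\<lambda>e. G (e 0) (e 1))" and total: "\<And>i. \<exists>x. G i x"
  obtains F where "fn F" "\<And>i. G i (app M F i)"
proof -
  let ?H = "\<lambda>i x. G i x \<and> (\<forall>y. y \<prec> x \<longrightarrow> \<not> G i y)"
  have "bdef (\<lambda>e. ?H (e 0) (e 1))"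
    by (intro bdef_conj bdef_ball bdef_not bdef_subst2[OF G] tdef_var)
  moreover have "\<exists>!x. ?H i x" for i
  proof -
    obtain x where "G i x" using total by blast
    moreover have "bdef (\<lambda>e. G i (e 0))" by (intro bdef_subst2[OF G] tdef_var tdef_const)
    ultimately obtain m where m: "G i m" "\<And>k. k \<prec> m \<Longrightarrow> \<not> G i k"
      using least_element[of "G i"] by blast
    show ?thesis
    proof (rule ex1I)
      show "?H i m" using m by blast
      show "x = m" if "?H i x" for x using that m trichotomy[of x m] by blast
    qed
  qed
  ultimately obtain F where F: "fn F" "\<And>i x. app M F i = x \<longleftrightarrow> ?H i x"
    by (rule fn_from_graph[of ?H]) (rule that)
  have "G i (app M F i)" for i using F(2)[of i "app M F i"] by simp
  with F(1) show thesis by (rule that)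
qed

end

context rca0_ctl
begin

text \<open>Only finitely many components of the environment matter. They are packed into one code,
  the codes for which a witness exists form a set by \<open>sigma1_comprehension\<close>, and
  membership in this set parameter replaces the unbounded quantifier.\<close>

lemma bdef_ex:
  assumes "bdef (\<lambda>e. Q (\<lambda>n. e (Suc n)) (e 0))"
  shows "bdef (\<lambda>e. \<exists>a. Q e a)"
proof -
  from bdef_finite_support[OF assms]
  obtain K where *: "\<forall>e e'. (\<forall>n<K. e n = e' n) \<longrightarrow> (Q (\<lambda>n. e (Suc n)) (e 0) \<longleftrightarrow> Q (\<lambda>n. e' (Suc n)) (e' 0))"
    by (rule exE)
  have K: "Q e a \<longleftrightarrow> Q e' a" if "\<forall>n<K. e n = e' n" for e e' a
    using *[THEN spec, THEN spec, of "case_nat a e" "case_nat a e'"] that by (simp split: nat.split)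
  \<comment> \<open>The quantified value is moved to component \<open>K\<close>, so that it becomes
    component 1 once the first \<open>K\<close> components are read off a code.\<close>
  have "bdef (\<lambda>e. Q e (e K))"
    using bdef_ren[OF assms, of "case_nat K (\<lambda>n. n)"] by simp
  from bdef_decode[OF this, of K]
  have "bdef (\<lambda>e. \<exists>s. enc K s = e 0 \<and> Q (\<lambda>n. if n < K then s n else e (Suc (n - K))) (e 1))" by simp
  moreover have "Q (\<lambda>n. if n < K then s n else e (Suc (n - K))) (e 1) \<longleftrightarrow> Q s (e 1)" for s e
    by (rule K) simp
  ultimately have "bdef (\<lambda>e. \<exists>s. enc K s = e 0 \<and> Q s (e 1))" by (simp only:)
  then have X: "{c. \<exists>y. \<exists>s. enc K s = c \<and> Q s y} \<in> sets M" (is "?X \<in> _")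
    by (intro sigma1_comprehension)
  have "bdef (\<lambda>e. enc K e \<in> ?X)"
    by (rule bdef_mem[OF tdef_enc X]) (rule tdef_var)
  moreover have "enc K e \<in> ?X \<longleftrightarrow> (\<exists>a. Q e a)" for e
  proof
    assume "enc K e \<in> ?X"
    then obtain y s where "\<forall>n<K. s n = e n" "Q s y" by (auto simp: enc_eq_iff)
    then show "\<exists>a. Q e a" using K by blast
  qed blast
  ultimately show ?thesis by (simp only:)
qed

lemma bdef_all:
  assumes "bdef (\<lambda>e. Q (\<lambda>n. e (Suc n)) (e 0))"
  shows "bdef (\<lambda>e. \<forall>a. Q e a)"
proof -
  have "bdef (\<lambda>e. \<not> (\<exists>a. \<not> Q e a))" by (intro bdef_not bdef_ex assms)
  then show ?thesis by (simp only: not_ex not_not)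
qed

text \<open>A quantifier over whole environments amounts to finitely many number quantifiers.\<close>

lemma bdef_ex_env:
  assumes "bdef (\<lambda>e. Q (\<lambda>n. e (2 * n)) (\<lambda>n. e (2 * n + 1)))"
  shows "bdef (\<lambda>e. \<exists>s. Q e s)"
proof -
  let ?P = "\<lambda>e. Q (\<lambda>n. e (2 * n)) (\<lambda>n. e (2 * n + 1))"
  from bdef_finite_support[OF assms]
  obtain N where N: "\<forall>e e'. (\<forall>n<N. e n = e' n) \<longrightarrow> (?P e \<longleftrightarrow> ?P e')" by (rule exE)
  \<comment> \<open>Even positions belong to \<open>e\<close>, stored after the first
    \<open>N\<close> components, and odd ones to \<open>s\<close>. The default 0 is taken only at
    positions beyond the support.\<close>
  let ?k = "\<lambda>n. if even n then N + n div 2 else if n div 2 < N then n div 2 else 0"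
  have 1: "?P (\<lambda>n. (\<lambda>m. if m < N then s m else e (Suc (m - N))) (?k n)) \<longleftrightarrow> Q (\<lambda>n. e (Suc n)) s" for s e
  proof -
    have "?P (\<lambda>n. (\<lambda>m. if m < N then s m else e (Suc (m - N))) (?k n)) \<longleftrightarrow>
        ?P (\<lambda>n. if even n then e (Suc (n div 2)) else s (n div 2))"
      by (rule N[rule_format]) simp
    then show ?thesis by simp
  qed
  have "(\<lambda>e. \<exists>s. enc N s = e 0 \<and> ?P (\<lambda>n. (\<lambda>m. if m < N then s m else e (Suc (m - N))) (?k n))) =
      (\<lambda>e. \<exists>s. enc N s = e 0 \<and> Q (\<lambda>n. e (Suc n)) s)"
    by (intro ext ex_cong1 conj_cong refl 1)
  then have "bdef (\<lambda>e. \<exists>s. enc N s = e 0 \<and> Q (\<lambda>n. e (Suc n)) s)"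
    by (rule subst[where P = bdef]) (rule bdef_decode[OF bdef_ren[OF assms, of ?k], of N])
  then have "bdef (\<lambda>e. \<exists>a. \<exists>s. enc N s = a \<and> Q e s)" by (rule bdef_ex)
  then show ?thesis by simp
qed

lemma bdef_subst_env:
  assumes "bdef P" "\<And>n. tdef (\<lambda>e. T e n)"
  shows "bdef (\<lambda>e. P (T e))"
proof -
  from bdef_finite_support[OF assms(1)]
  obtain K where K: "\<forall>e e'. (\<forall>n<K. e n = e' n) \<longrightarrow> (P e \<longleftrightarrow> P e')" by (rule exE)
  have "bdef (\<lambda>e. \<exists>s. enc K s = enc K (T e) \<and> P s)"
    by (intro bdef_ex_env bdef_conj bdef_eq tdef_enc tdef_var bdef_ren[OF assms(1)] tdef_ren[OF assms(2)])
  moreover have "(\<exists>s. enc K s = enc K (T e) \<and> P s) \<longleftrightarrow> P (T e)" for e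
    unfolding enc_eq_iff using K by blast
  ultimately show ?thesis by (simp only:)
qed

end

section \<open>Trees of finite sequences\<close>

lemma (in rca0) fn_in_sets: "fn F \<Longrightarrow> F \<in> sets M"
  by (simp add: is_function_def)

context rca0_ctl
begin

lemmas adef_intros = bdef_const bdef_eq bdef_less bdef_not bdef_conj bdef_disj bdef_imp
  bdef_iff bdef_ex bdef_all tdef_var tdef_const tdef_add tdef_mul tdef_pair

lemma tdef_case_nat: "tdef T \<Longrightarrow> (\<And>m. tdef (\<lambda>e. U e m)) \<Longrightarrow> tdef (\<lambda>e. case_nat (T e) (U e) n)"
  by (cases n) simp_all

lemma bdef_subst4:
  assumes "bdef (\<lambda>e. B (e 0) (e 1) (e 2) (e 3))" "tdef S" "tdef T" "tdef U" "tdef V"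
  shows "bdef (\<lambda>e. B (S e) (T e) (U e) (V e))"
proof -
  let ?T = "\<lambda>e. case_nat (S e) (case_nat (T e) (case_nat (U e) (\<lambda>_. V e)))"
  have "bdef (\<lambda>e. B (?T e 0) (?T e 1) (?T e 2) (?T e 3))"
  proof (rule bdef_subst_env[OF assms(1), of ?T])
    show "tdef (\<lambda>e. ?T e n)" for n
      by (intro tdef_case_nat assms)
  qed
  then show ?thesis by (simp add: numeral_2_eq_2 numeral_3_eq_3)
qed

lemma bdef_fn_mem: "fn F \<Longrightarrow> tdef T \<Longrightarrow> bdef (\<lambda>e. T e \<in> F)"
  by (rule bdef_mem[OF _ fn_in_sets])

text \<open>Lists are coded by \<open>0\<close> (empty) and \<open>pairN M c q \<oplus> \<one>\<close>.  A path from \<open>pairN M c p\<close> discards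
  entries until \<open>p\<close> is found, where it may stay forever.\<close>

lemma list_membership:
  obtains L where "L \<in> sets M" "\<And>p. pairN M \<zero> p \<notin> L"
    "\<And>c q p. pairN M (pairN M c q \<oplus> \<one>) p \<in> L \<longleftrightarrow> p = q \<or> pairN M c p \<in> L"
proof -
  let ?R = "\<lambda>w u. \<exists>c q p. w = pairN M (pairN M c q \<oplus> \<one>) p \<and> (p = q \<and> u = w \<or> p \<noteq> q \<and> u = pairN M c p)"
  have "bdef (\<lambda>e. ?R (e 0) (e 1))" by (intro adef_intros)
  then obtain L where L: "L \<in> sets M" "\<And>w. w \<in> L \<longleftrightarrow> (\<exists>u. ?R w u \<and> u \<in> L)" "\<And>w. ?R w w \<Longrightarrow> w \<in> L"
    by (rule path_fixpoint[of ?R]) (rule that)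
  show thesis
  proof (rule that[OF L(1)])
    show "pairN M \<zero> p \<notin> L" for p using L(2)[of "pairN M \<zero> p"] by simp
    show "pairN M (pairN M c q \<oplus> \<one>) p \<in> L \<longleftrightarrow> p = q \<or> pairN M c p \<in> L" for c q p
    proof (cases "p = q")
      case True
      then have "pairN M (pairN M c q \<oplus> \<one>) p \<in> L" by (intro L(3)) auto
      then show ?thesis using True by blast
    next
      case False
      then show ?thesis by (subst L(2)) auto
    qed
  qed
qed

text \<open>The tree of finite sequences, entries stored as pairs (position, value) in a list.  A node also
  carries the parameter \<open>a\<close>, so that one set handles all trees at once.\<close>

lemma tree_comprehension:
  assumes B: "bdef (\<lambda>e. B (e 0) (e 1) (e 2) (e 3))"
  shows "{a. \<exists>F. fn F \<and> (\<forall>p\<in>F. \<forall>q\<in>F. \<forall>r\<in>F. \<not> B a p q r)} \<in> sets M"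
proof -
  obtain L where L: "L \<in> sets M" and nil: "\<And>p. pairN M \<zero> p \<notin> L"
    and cons: "\<And>c q p. pairN M (pairN M c q \<oplus> \<one>) p \<in> L \<longleftrightarrow> p = q \<or> pairN M c p \<in> L"
    by (rule list_membership) (rule that)
  let ?node = "\<lambda>a n c. pairN M a (pairN M n c)"
  let ?cons = "\<lambda>c n x. pairN M c (pairN M n x) \<oplus> \<one>"
  let ?ok = "\<lambda>a c. \<forall>p q r. pairN M c p \<in> L \<and> pairN M c q \<in> L \<and> pairN M c r \<in> L \<longrightarrow> \<not> B a p q r"
  let ?R = "\<lambda>w u. \<exists>a n c x. w = ?node a n c \<and> u = ?node a (n \<oplus> \<one>) (?cons c n x) \<and> ?ok a (?cons c n x)"
  \<comment> \<open>\<open>?ok\<close> has unbounded quantifiers; they are admissible by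
    \<open>bdef_all\<close>.\<close>
  have "bdef (\<lambda>e. ?R (e 0) (e 1))" by (intro adef_intros bdef_subst4[OF B] bdef_mem[OF _ L])
  then obtain S where S: "S \<in> sets M"
    "\<And>w. w \<in> S \<longleftrightarrow> (\<exists>f. fn f \<and> app M f \<zero> = w \<and> (\<forall>i. ?R (app M f i) (app M f (i \<oplus> \<one>))))"
    by (rule path_set[of ?R]) (rule that)
  have "?node a \<zero> \<zero> \<in> S \<longleftrightarrow> (\<exists>F. fn F \<and> (\<forall>p\<in>F. \<forall>q\<in>F. \<forall>r\<in>F. \<not> B a p q r))" for a
  proof
    assume "?node a \<zero> \<zero> \<in> S"
    then obtain f where f: "fn f" "app M f \<zero> = ?node a \<zero> \<zero>" "\<forall>i. ?R (app M f i) (app M f (i \<oplus> \<one>))"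
      unfolding S(2) by (elim exE conjE) (rule that)
    have node: "\<exists>c. app M f i = ?node a i c" for i
    proof (rule bdef_induct[where a = i])
      show "bdef (\<lambda>e. \<exists>c. app M f (e 0) = ?node a (e 0) c)" by (intro adef_intros bdef_app f(1))
      show "\<exists>c. app M f \<zero> = ?node a \<zero> c" using f(2) by blast
      fix i assume "\<exists>c. app M f i = ?node a i c"
      then show "\<exists>c. app M f (i \<oplus> \<one>) = ?node a (i \<oplus> \<one>) c" using f(3)[rule_format, of i] by auto
    qed
    have step: "\<exists>x. app M f (i \<oplus> \<one>) = ?node a (i \<oplus> \<one>) (?cons c i x) \<and> ?ok a (?cons c i x)"
      if "app M f i = ?node a i c" for i c
      using f(3)[rule_format, of i] unfolding that by auto
    \<comment> \<open>The value at \<open>i\<close> is the entry put at the head of the list by the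
      step from \<open>i\<close> to its successor.\<close>
    let ?G = "\<lambda>i x. \<exists>c. app M f (i \<oplus> \<one>) = ?node a (i \<oplus> \<one>) (?cons c i x)"
    have "bdef (\<lambda>e. ?G (e 0) (e 1))" by (intro adef_intros bdef_app f(1))
    moreover have "\<exists>!x. ?G i x" for i
    proof -
      obtain c where "app M f i = ?node a i c" using node by blast
      from step[OF this] obtain x where "?G i x" by blast
      then show ?thesis by (rule ex1I) (use \<open>?G i x\<close> in auto)
    qed
    ultimately obtain F where F: "fn F" "\<And>i x. app M F i = x \<longleftrightarrow> ?G i x"
      by (rule fn_from_graph[of ?G]) (rule that)
    have FG: "pairN M i x \<in> F \<longleftrightarrow> ?G i x" for i x
      by (simp only: app_eq_iff[OF F(1) UNIV_I, symmetric] F(2))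
    \<comment> \<open>Entries are never lost along the path: those with positions below
      \<open>N\<close> are all in the list at stage \<open>N\<close>.\<close>
    have in_list: "\<forall>i x c. i \<prec> N \<and> pairN M i x \<in> F \<and> app M f N = ?node a N c \<longrightarrow> pairN M c (pairN M i x) \<in> L" for N
    proof (rule bdef_induct[where a = N])
      show "bdef (\<lambda>e. \<forall>i x c. i \<prec> e 0 \<and> pairN M i x \<in> F \<and> app M f (e 0) = ?node a (e 0) c
          \<longrightarrow> pairN M c (pairN M i x) \<in> L)"
        by (intro adef_intros bdef_app f(1) bdef_fn_mem F(1) bdef_mem[OF _ L])
      show "\<forall>i x c. i \<prec> \<zero> \<and> pairN M i x \<in> F \<and> app M f \<zero> = ?node a \<zero> c \<longrightarrow> pairN M c (pairN M i x) \<in> L"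
        by simp
      fix N assume IH: "\<forall>i x c. i \<prec> N \<and> pairN M i x \<in> F \<and> app M f N = ?node a N c \<longrightarrow> pairN M c (pairN M i x) \<in> L"
      show "\<forall>i x c. i \<prec> N \<oplus> \<one> \<and> pairN M i x \<in> F \<and> app M f (N \<oplus> \<one>) = ?node a (N \<oplus> \<one>) c \<longrightarrow> pairN M c (pairN M i x) \<in> L"
      proof (intro allI impI; elim conjE)
        fix i x c assume i: "i \<prec> N \<oplus> \<one>" and ix: "pairN M i x \<in> F"
          and c: "app M f (N \<oplus> \<one>) = ?node a (N \<oplus> \<one>) c"
        obtain d where d: "app M f N = ?node a N d" using node by blast
        from step[OF d] obtain y where "c = ?cons d N y" unfolding c by auto
        moreover have "y = x" if "i = N"
          using ix c \<open>c = ?cons d N y\<close> unfolding FG that by auto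
        moreover have "pairN M d (pairN M i x) \<in> L" if "i \<prec> N" using IH that ix d by blast
        ultimately show "pairN M c (pairN M i x) \<in> L" using i cons by (auto simp: less_succ)
      qed
    qed
    have "\<not> B a p q r" if pqr: "p \<in> F" "q \<in> F" "r \<in> F" for p q r
    proof -
      have "\<exists>i x. p = pairN M i x" if "p \<in> F" for p
        using that F(1) unfolding is_function_def prodN_def by blast
      with pqr obtain i x j y k z where p: "p = pairN M i x" and q: "q = pairN M j y" and r: "r = pairN M k z"
        by metis
      \<comment> \<open>The sum bounds all three positions, so the list at the next stage, which
        \<open>?ok\<close> has checked, contains all three entries.\<close>
      let ?N = "i \<oplus> (j \<oplus> k)"
      have less: "i \<prec> ?N \<oplus> \<one>" "j \<prec> ?N \<oplus> \<one>" "k \<prec> ?N \<oplus> \<one>"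
        unfolding less_iff
        by (rule exI[of _ "j \<oplus> k"], simp only: add_ac) (rule exI[of _ "i \<oplus> k"], simp only: add_ac,
            rule exI[of _ "i \<oplus> j"], simp only: add_ac)
      obtain d where "app M f ?N = ?node a ?N d" using node by blast
      from step[OF this] obtain c where c: "app M f (?N \<oplus> \<one>) = ?node a (?N \<oplus> \<one>) c" "?ok a c" by blast
      then show ?thesis
        using in_list[of "?N \<oplus> \<one>"] less pqr unfolding p q r by blast
    qed
    then show "\<exists>F. fn F \<and> (\<forall>p\<in>F. \<forall>q\<in>F. \<forall>r\<in>F. \<not> B a p q r)" using F(1) by blast
  next
    assume "\<exists>F. fn F \<and> (\<forall>p\<in>F. \<forall>q\<in>F. \<forall>r\<in>F. \<not> B a p q r)"
    then obtain F where F: "fn F" and good: "\<And>p q r. p \<in> F \<Longrightarrow> q \<in> F \<Longrightarrow> r \<in> F \<Longrightarrow> \<not> B a p q r" by blast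
    \<comment> \<open>Primitive recursion run backwards: a stage and a list step down to the
      previous stage and the tail, provided that the head is an entry of \<open>F\<close>, and the
      empty list at stage 0 loops. Thus \<open>I\<close> relates each \<open>i\<close> to the code
      of the first \<open>i\<close> entries of \<open>F\<close>.\<close>
    let ?T = "\<lambda>w u. (w = pairN M \<zero> \<zero> \<and> u = w) \<or>
      (\<exists>j c x. w = pairN M (j \<oplus> \<one>) (?cons c j x) \<and> pairN M j x \<in> F \<and> u = pairN M j c)"
    have "bdef (\<lambda>e. ?T (e 0) (e 1))" by (intro adef_intros bdef_fn_mem F)
    then obtain I where I: "I \<in> sets M" "\<And>w. w \<in> I \<longleftrightarrow> (\<exists>u. ?T w u \<and> u \<in> I)" "\<And>w. ?T w w \<Longrightarrow> w \<in> I"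
      by (rule path_fixpoint[of ?T]) (rule that)
    have I0: "pairN M \<zero> c \<in> I \<longleftrightarrow> c = \<zero>" for c
      using I(2)[of "pairN M \<zero> c"] I(3)[of "pairN M \<zero> c"] by auto
    have Is: "pairN M (j \<oplus> \<one>) c \<in> I \<longleftrightarrow> (\<exists>d x. c = ?cons d j x \<and> pairN M j x \<in> F \<and> pairN M j d \<in> I)" for j c
      by (subst I(2)) auto
    have ex1: "\<exists>c. pairN M i c \<in> I \<and> (\<forall>d. pairN M i d \<in> I \<longrightarrow> d = c)" for i
    proof (rule bdef_induct[where a = i])
      show "bdef (\<lambda>e. \<exists>c. pairN M (e 0) c \<in> I \<and> (\<forall>d. pairN M (e 0) d \<in> I \<longrightarrow> d = c))"
        by (intro adef_intros bdef_mem[OF _ I(1)])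
      show "\<exists>c. pairN M \<zero> c \<in> I \<and> (\<forall>d. pairN M \<zero> d \<in> I \<longrightarrow> d = c)" by (simp add: I0)
      fix i assume "\<exists>c. pairN M i c \<in> I \<and> (\<forall>d. pairN M i d \<in> I \<longrightarrow> d = c)"
      then obtain c where c: "pairN M i c \<in> I" "\<And>d. pairN M i d \<in> I \<Longrightarrow> d = c" by blast
      have x: "pairN M i x \<in> F \<longleftrightarrow> x = app M F i" for x using app_eq_iff[OF F UNIV_I] by metis
      show "\<exists>c. pairN M (i \<oplus> \<one>) c \<in> I \<and> (\<forall>d. pairN M (i \<oplus> \<one>) d \<in> I \<longrightarrow> d = c)"
        unfolding Is x by (rule exI[of _ "?cons c i (app M F i)"]) (use c in blast)
    qed
    let ?G = "\<lambda>i w. \<exists>c. w = ?node a i c \<and> pairN M i c \<in> I"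
    have "bdef (\<lambda>e. ?G (e 0) (e 1))" by (intro adef_intros bdef_mem[OF _ I(1)])
    moreover have "\<exists>!w. ?G i w" for i
    proof -
      obtain c where "pairN M i c \<in> I" "\<forall>d. pairN M i d \<in> I \<longrightarrow> d = c" using ex1 by blast
      then show ?thesis by (intro ex1I[of _ "?node a i c"]) blast+
    qed
    ultimately obtain f where f: "fn f" "\<And>i w. app M f i = w \<longleftrightarrow> ?G i w"
      by (rule fn_from_graph[of ?G]) (rule that)
    have elem: "\<forall>c p. pairN M i c \<in> I \<and> pairN M c p \<in> L \<longrightarrow> p \<in> F" for i
    proof (rule bdef_induct[where a = i])
      show "bdef (\<lambda>e. \<forall>c p. pairN M (e 0) c \<in> I \<and> pairN M c p \<in> L \<longrightarrow> p \<in> F)"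
        by (intro adef_intros bdef_mem[OF _ I(1)] bdef_mem[OF _ L] bdef_fn_mem F)
      show "\<forall>c p. pairN M \<zero> c \<in> I \<and> pairN M c p \<in> L \<longrightarrow> p \<in> F" by (simp add: I0 nil)
      fix i assume "\<forall>c p. pairN M i c \<in> I \<and> pairN M c p \<in> L \<longrightarrow> p \<in> F"
      then show "\<forall>c p. pairN M (i \<oplus> \<one>) c \<in> I \<and> pairN M c p \<in> L \<longrightarrow> p \<in> F"
        unfolding Is by (auto simp: cons)
    qed
    have "?R (app M f i) (app M f (i \<oplus> \<one>))" for i
    proof -
      obtain c' where c': "app M f (i \<oplus> \<one>) = ?node a (i \<oplus> \<one>) c'" "pairN M (i \<oplus> \<one>) c' \<in> I"
        using f(2)[of "i \<oplus> \<one>" "app M f (i \<oplus> \<one>)"] by auto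
      then obtain c x where c: "c' = ?cons c i x" "pairN M i c \<in> I" unfolding Is by blast
      have "app M f i = ?node a i c" unfolding f(2) using c(2) by blast
      moreover have "?ok a c'" using elem[of "i \<oplus> \<one>"] c'(2) good by blast
      ultimately show ?thesis using c'(1) unfolding c(1) by blast
    qed
    moreover have "app M f \<zero> = ?node a \<zero> \<zero>" unfolding f(2) by (simp add: I0)
    ultimately show "?node a \<zero> \<zero> \<in> S" unfolding S(2) using f(1) by blast
  qed
  moreover have "{a. ?node a \<zero> \<zero> \<in> S} \<in> sets M" by (intro bdef_comprehension bdef_intros S(1))
  ultimately show ?thesis by (simp only:)
qed

end

section \<open>Truth tables\<close>

instance tm :: countable by countable_datatype
instance fm :: countable by countable_datatype

text \<open>With the other connectives and the universal quantifier eliminated, few Tarski clauses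
  remain and only existential formulas need witnesses.\<close>

primrec basic :: "fm \<Rightarrow> bool" where
  "basic (Eq s t) \<longleftrightarrow> True"
| "basic (Less s t) \<longleftrightarrow> True"
| "basic (Mem t X) \<longleftrightarrow> True"
| "basic (Neg \<phi>) \<longleftrightarrow> basic \<phi>"
| "basic (Conj \<phi> \<psi>) \<longleftrightarrow> basic \<phi> \<and> basic \<psi>"
| "basic (Disj \<phi> \<psi>) \<longleftrightarrow> False"
| "basic (Imp \<phi> \<psi>) \<longleftrightarrow> False"
| "basic (AllN x \<phi>) \<longleftrightarrow> False"
| "basic (ExN x \<phi>) \<longleftrightarrow> basic \<phi>"
| "basic (AllS X \<phi>) \<longleftrightarrow> False"
| "basic (ExS X \<phi>) \<longleftrightarrow> False"

primrec to_basic :: "fm \<Rightarrow> fm" where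
  "to_basic (Eq s t) = Eq s t"
| "to_basic (Less s t) = Less s t"
| "to_basic (Mem t X) = Mem t X"
| "to_basic (Neg \<phi>) = Neg (to_basic \<phi>)"
| "to_basic (Conj \<phi> \<psi>) = Conj (to_basic \<phi>) (to_basic \<psi>)"
| "to_basic (Disj \<phi> \<psi>) = Neg (Conj (Neg (to_basic \<phi>)) (Neg (to_basic \<psi>)))"
| "to_basic (Imp \<phi> \<psi>) = Neg (Conj (to_basic \<phi>) (Neg (to_basic \<psi>)))"
| "to_basic (AllN x \<phi>) = Neg (ExN x (Neg (to_basic \<phi>)))"
| "to_basic (ExN x \<phi>) = ExN x (to_basic \<phi>)"
| "to_basic (AllS X \<phi>) = AllS X \<phi>"
| "to_basic (ExS X \<phi>) = ExS X \<phi>"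

lemma basic_to_basic: "arithmetical \<phi> \<Longrightarrow> basic (to_basic \<phi>)"
  by (induction \<phi>) auto

lemma sat_to_basic: "sat M e E (to_basic \<phi>) \<longleftrightarrow> sat M e E \<phi>"
  by (induction \<phi> arbitrary: e E) auto

primrec subfms :: "fm \<Rightarrow> fm set" where
  "subfms (Eq s t) = {Eq s t}"
| "subfms (Less s t) = {Less s t}"
| "subfms (Mem t X) = {Mem t X}"
| "subfms (Neg \<phi>) = insert (Neg \<phi>) (subfms \<phi>)"
| "subfms (Conj \<phi> \<psi>) = insert (Conj \<phi> \<psi>) (subfms \<phi> \<union> subfms \<psi>)"
| "subfms (Disj \<phi> \<psi>) = insert (Disj \<phi> \<psi>) (subfms \<phi> \<union> subfms \<psi>)"
| "subfms (Imp \<phi> \<psi>) = insert (Imp \<phi> \<psi>) (subfms \<phi> \<union> subfms \<psi>)"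
| "subfms (AllN x \<phi>) = insert (AllN x \<phi>) (subfms \<phi>)"
| "subfms (ExN x \<phi>) = insert (ExN x \<phi>) (subfms \<phi>)"
| "subfms (AllS X \<phi>) = insert (AllS X \<phi>) (subfms \<phi>)"
| "subfms (ExS X \<phi>) = insert (ExS X \<phi>) (subfms \<phi>)"

lemma subfms_refl: "\<phi> \<in> subfms \<phi>"
  by (cases \<phi>) auto

lemma finite_subfms: "finite (subfms \<phi>)"
  by (induction \<phi>) auto

lemma subfms_mono: "\<phi> \<in> subfms \<theta> \<Longrightarrow> subfms \<phi> \<subseteq> subfms \<theta>"
  by (induction \<theta>) auto

lemma fm_vars_subfms: "\<phi> \<in> subfms \<theta> \<Longrightarrow> fm_vars \<phi> \<subseteq> fm_vars \<theta>"
  by (induction \<theta>) auto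

lemma basic_subfms: "\<phi> \<in> subfms \<theta> \<Longrightarrow> basic \<theta> \<Longrightarrow> basic \<phi>"
  by (induction \<theta>) auto

context rca0
begin

lemma numeralN_inject [simp]: "numeralN M m = numeralN M n \<longleftrightarrow> m = n"
proof (induction m arbitrary: n)
  case 0
  show ?case by (cases n) auto
next
  case (Suc m)
  show ?case by (cases n) (auto simp: Suc)
qed

text \<open>The successor in the tag keeps the truth tables apart from row 0, which holds the set.
  Assignments are recorded only on the variables below \<open>K\<close>.\<close>

definition row :: "nat \<Rightarrow> fm \<Rightarrow> (nat \<Rightarrow> 'a) \<Rightarrow> 'a" where
  "row K \<phi> s = pairN M (numeralN M (Suc (to_nat \<phi>))) (enc K s)"

lemma row_eq_iff: "row K \<phi> s = row K \<psi> s' \<longleftrightarrow> \<phi> = \<psi> \<and> enc K s = enc K s'"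
  by (simp add: row_def)

lemma row_ne [simp]: "row K \<phi> s \<noteq> pairN M \<zero> m"
  by (simp add: row_def)

lemma tdef_row: "(\<And>n. tdef (\<lambda>e. S e n)) \<Longrightarrow> tdef (\<lambda>e. row K \<phi> (S e))"
  unfolding row_def by (intro tdef_pair tdef_const tdef_enc)

lemma tdef_upd: "(\<And>n. tdef (\<lambda>e. S e n)) \<Longrightarrow> tdef U \<Longrightarrow> tdef (\<lambda>e. ((S e)(y := U e)) n)"
  by (cases "n = y") simp_all

lemma tdef_eval: "(\<And>n. tdef (\<lambda>e. S e n)) \<Longrightarrow> tdef (\<lambda>e. eval M (S e) t)"
proof (induction t)
  case (Add s t)
  show ?case unfolding eval.simps by (intro tdef_add Add)
next
  case (Mul s t)
  show ?case unfolding eval.simps by (intro tdef_mul Mul)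
qed (simp_all only: eval.simps tdef_const)

text \<open>A function \<open>F\<close> codes a set, in its row 0, and the truth tables of formulas in which that set
  interprets the variable \<open>X\<close>: a value is non-zero iff the formula is true, and the value of a true
  existential formula is one more than a witness.  The Tarski clause of \<open>\<phi>\<close> then is violated
  by at most three entries \<open>p, q, r\<close> of \<open>F\<close>.\<close>

definition viol :: "nat \<Rightarrow> nat \<Rightarrow> (nat \<Rightarrow> 'a set) \<Rightarrow> fm \<Rightarrow> (nat \<Rightarrow> 'a) \<Rightarrow> 'a \<Rightarrow> 'a \<Rightarrow> 'a \<Rightarrow> bool" where
  "viol K X E \<phi> s p q r \<longleftrightarrow> (\<exists>v. p = pairN M (row K \<phi> s) v \<and> (case \<phi> of
      Eq t t' \<Rightarrow> (v = \<zero>) = (eval M s t = eval M s t')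
    | Less t t' \<Rightarrow> (v = \<zero>) = (eval M s t \<prec> eval M s t')
    | Mem t Y \<Rightarrow> if Y = X then \<exists>u. q = pairN M (pairN M \<zero> (eval M s t)) u \<and> (v = \<zero>) \<noteq> (u = \<zero>)
        else (v = \<zero>) = (eval M s t \<in> E Y)
    | Neg \<psi> \<Rightarrow> \<exists>u. q = pairN M (row K \<psi> s) u \<and> (v = \<zero>) = (u = \<zero>)
    | Conj \<psi> \<chi> \<Rightarrow> \<exists>u u'. q = pairN M (row K \<psi> s) u \<and> r = pairN M (row K \<chi> s) u' \<and>
        (v = \<zero>) = (u \<noteq> \<zero> \<and> u' \<noteq> \<zero>)
    | ExN y \<psi> \<Rightarrow> \<exists>w u. q = pairN M (row K \<psi> (s(y := w))) u \<and> (v = \<zero> \<and> u \<noteq> \<zero> \<or> v = w \<oplus> \<one> \<and> u = \<zero>)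
    | _ \<Rightarrow> False))"

text \<open>The specification of a correct table entry. It leaves several values open for a true
  formula, among which \<open>uniformization\<close> selects.\<close>

definition good :: "(nat \<Rightarrow> 'a set) \<Rightarrow> fm \<Rightarrow> (nat \<Rightarrow> 'a) \<Rightarrow> 'a \<Rightarrow> bool" where
  "good E \<phi> s v \<longleftrightarrow> (v = \<zero> \<longleftrightarrow> \<not> sat M s E \<phi>) \<and>
    (case \<phi> of ExN y \<psi> \<Rightarrow> \<forall>w. v = w \<oplus> \<one> \<longrightarrow> sat M (s(y := w)) E \<psi> | _ \<Rightarrow> True)"

lemma good_ex: "\<exists>v. good E \<phi> s v"
proof (cases "sat M s E \<phi> \<and> (\<exists>y \<psi>. \<phi> = ExN y \<psi>)")
  case True
  then obtain y \<psi> w where "\<phi> = ExN y \<psi>" "sat M (s(y := w)) E \<psi>" by auto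
  then have "good E \<phi> s (w \<oplus> \<one>)" unfolding good_def by auto
  then show ?thesis by blast
next
  case False
  then have "good E \<phi> s (if sat M s E \<phi> then \<one> else \<zero>)"
    unfolding good_def by (auto split: fm.split)
  then show ?thesis by blast
qed

lemma good_cong:
  assumes "\<And>n. n \<in> fm_vars \<phi> \<Longrightarrow> s n = s' n"
  shows "good E \<phi> s v \<longleftrightarrow> good E \<phi> s' v"
proof -
  have 1: "sat M s E \<phi> \<longleftrightarrow> sat M s' E \<phi>" by (rule sat_cong) (rule assms)
  have 2: "sat M (s(y := w)) E \<psi> \<longleftrightarrow> sat M (s'(y := w)) E \<psi>" if "\<phi> = ExN y \<psi>" for y \<psi> w
    by (rule sat_cong) (use assms that in auto)
  show ?thesis unfolding good_def 1 using 2 by (cases \<phi>) simp_all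
qed

end

context rca0_ctl
begin

section \<open>Definability of the conditions on truth tables\<close>

lemma bdef_fin_ex:
  assumes "finite A" "\<And>x. x \<in> A \<Longrightarrow> bdef (P x)"
  shows "bdef (\<lambda>e. \<exists>x\<in>A. P x e)"
  using assms
proof (induction A)
  case empty
  show ?case by (simp add: bdef_const)
next
  case (insert x A)
  have "bdef (\<lambda>e. P x e \<or> (\<exists>x\<in>A. P x e))" by (intro bdef_disj insert) simp_all
  then show ?case by simp
qed

lemma bdef_fin_all:
  assumes "finite A" "\<And>x. x \<in> A \<Longrightarrow> bdef (P x)"
  shows "bdef (\<lambda>e. \<forall>x\<in>A. P x e)"
proof -
  have "bdef (\<lambda>e. \<not> (\<exists>x\<in>A. \<not> P x e))" by (intro bdef_not bdef_fin_ex assms)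
  then show ?thesis by simp
qed

lemma bdef_all_env:
  assumes "bdef (\<lambda>e. Q (\<lambda>n. e (2 * n)) (\<lambda>n. e (2 * n + 1)))"
  shows "bdef (\<lambda>e. \<forall>s. Q e s)"
proof -
  have "bdef (\<lambda>e. \<not> (\<exists>s. \<not> Q e s))" by (intro bdef_not bdef_ex_env assms)
  then show ?thesis by (simp only: not_ex not_not)
qed

text \<open>For each fixed formula, satisfaction is definable by recursion outside the model;
  \<open>bdef_ex\<close> handles the quantifier.\<close>

lemma bdef_sat:
  assumes "basic \<phi>" "range E \<subseteq> sets M" "\<And>n. tdef (\<lambda>e. S e n)"
  shows "bdef (\<lambda>e. sat M (S e) E \<phi>)"
  using assms(1,3)
proof (induction \<phi> arbitrary: S)
  case (Eq s t)
  show ?case unfolding sat.simps by (intro bdef_eq tdef_eval Eq)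
next
  case (Less s t)
  show ?case unfolding sat.simps by (intro bdef_less tdef_eval Less)
next
  case (Mem t Y)
  have "E Y \<in> sets M" using assms(2) by auto
  then show ?case unfolding sat.simps by (intro bdef_mem tdef_eval Mem)
next
  case (Neg \<phi>)
  then show ?case unfolding sat.simps by (intro bdef_not Neg) simp_all
next
  case (Conj \<phi> \<psi>)
  then show ?case unfolding sat.simps by (intro bdef_conj Conj) simp_all
next
  case (ExN y \<phi>)
  have "basic \<phi>" using ExN.prems by simp
  then show ?case unfolding sat.simps
    by (intro bdef_ex ExN.IH tdef_upd tdef_var tdef_ren[OF ExN.prems(2)])
qed simp_all

lemma bdef_viol:
  assumes E: "range E \<subseteq> sets M" and S: "\<And>n. tdef (\<lambda>e. S e n)" and "tdef P" "tdef Q" "tdef R"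
  shows "bdef (\<lambda>e. viol K X E \<phi> (S e) (P e) (Q e) (R e))"
proof -
  have mem: "E Y \<in> sets M" for Y using E by auto
  note tdef = tdef_ren[OF S] tdef_ren[OF assms(3)] tdef_ren[OF assms(4)] tdef_ren[OF assms(5)]
    tdef_row tdef_eval tdef_upd
  note intros = bdef_ex bdef_conj bdef_disj bdef_not bdef_iff bdef_eq bdef_less bdef_mem[OF _ mem]
    bdef_const tdef_pair tdef_add tdef_var tdef_const tdef
  show ?thesis
  proof (cases \<phi>)
    case (Mem t Y)
    show ?thesis
    proof (cases "Y = X")
      case True
      show ?thesis unfolding viol_def Mem fm.case if_P[OF True] by (intro intros)
    next
      case False
      show ?thesis unfolding viol_def Mem fm.case if_not_P[OF False] by (intro intros)
    qed
  qed (simp only: viol_def fm.case, intro intros)+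
qed

lemma bdef_good:
  assumes "basic \<phi>" "range E \<subseteq> sets M" and S: "\<And>n. tdef (\<lambda>e. S e n)" and V: "tdef V"
  shows "bdef (\<lambda>e. good E \<phi> (S e) (V e))"
proof -
  have sat: "bdef (\<lambda>e. (V e = \<zero>) = (\<not> sat M (S e) E \<phi>))"
    by (intro bdef_iff bdef_not bdef_eq bdef_sat tdef_const assms)
  show ?thesis
  proof (cases "\<exists>y \<psi>. \<phi> = ExN y \<psi>")
    case True
    then obtain y \<psi> where \<phi>: "\<phi> = ExN y \<psi>" by blast
    then have "basic \<psi>" using assms(1) by simp
    have "bdef (\<lambda>e. (V e = \<zero>) = (\<not> sat M (S e) E \<phi>) \<and>
        (\<forall>w. V e = w \<oplus> \<one> \<longrightarrow> sat M ((S e)(y := w)) E \<psi>))"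
      by (intro bdef_conj sat bdef_all bdef_imp bdef_eq tdef_add tdef_var tdef_const
          bdef_sat[OF \<open>basic \<psi>\<close> assms(2)] tdef_upd tdef_ren[OF S] tdef_ren[OF V])
    then show ?thesis unfolding good_def \<phi> fm.case by simp
  next
    case False
    then have "good E \<phi> (S e) (V e) \<longleftrightarrow> (V e = \<zero>) = (\<not> sat M (S e) E \<phi>)" for e
      unfolding good_def by (cases \<phi>) simp_all
    with sat show ?thesis by (simp only:)
  qed
qed

text \<open>Without violations the entries of \<open>F\<close> obey Tarski's clauses, so structural
  induction applies. For an existential formula, value 0 rules out every witness and a successor
  names one.\<close>

lemma truth_table_sound:
  assumes F: "fn F" and X: "A = {m. app M F (pairN M \<zero> m) \<noteq> \<zero>}"
    and no_viol: "\<And>\<phi> s p q r. \<phi> \<in> subfms \<theta> \<Longrightarrow> p \<in> F \<Longrightarrow> q \<in> F \<Longrightarrow> r \<in> F \<Longrightarrow> \<not> viol K X E \<phi> s p q r"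
    and "basic \<theta>"
  shows "app M F (row K \<theta> s) = \<zero> \<longleftrightarrow> \<not> sat M s (E(X := A)) \<theta>"
proof -
  have F_app: "pairN M i (app M F i) \<in> F" for i
    using app_eq_iff[OF F UNIV_I] by metis
  have nv: "\<not> viol K X E \<phi> s (pairN M i (app M F i)) (pairN M j (app M F j)) (pairN M k (app M F k))"
    if "subfms \<phi> \<subseteq> subfms \<theta>" for \<phi> s i j k
    using no_viol[OF _ F_app F_app F_app] that subfms_refl by blast
  have "basic \<phi> \<Longrightarrow> subfms \<phi> \<subseteq> subfms \<theta> \<Longrightarrow> app M F (row K \<phi> s) = \<zero> \<longleftrightarrow> \<not> sat M s (E(X := A)) \<phi>" for \<phi>
  proof (induction \<phi> arbitrary: s)
    case (Eq t t')
    \<comment> \<open>The zeros fill the places of entries that this clause does not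
      inspect.\<close>
    from nv[OF Eq(2), of s "row K (Eq t t') s" \<zero> \<zero>] show ?case by (simp add: viol_def)
  next
    case (Less t t')
    from nv[OF Less(2), of s "row K (Less t t') s" \<zero> \<zero>] show ?case by (simp add: viol_def)
  next
    case (Mem t Y)
    from nv[OF Mem(2), of s "row K (Mem t Y) s" "pairN M \<zero> (eval M s t)" \<zero>]
    show ?case by (auto simp: viol_def X)
  next
    case (Neg \<psi>)
    from nv[OF Neg(3), of s "row K (Neg \<psi>) s" "row K \<psi> s" \<zero>] Neg
    show ?case by (simp add: viol_def)
  next
    case (Conj \<psi> \<chi>)
    from nv[OF Conj(4), of s "row K (Conj \<psi> \<chi>) s" "row K \<psi> s" "row K \<chi> s"] Conj
    show ?case by (simp add: viol_def)
  next
    case (ExN y \<psi>)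
    have IH: "app M F (row K \<psi> s) = \<zero> \<longleftrightarrow> \<not> sat M s (E(X := A)) \<psi>" for s
      by (rule ExN.IH) (use ExN.prems in auto)
    let ?v = "app M F (row K (ExN y \<psi>) s)"
    have *: "\<not> (?v = \<zero> \<and> sat M (s(y := w)) (E(X := A)) \<psi> \<or> ?v = w \<oplus> \<one> \<and> \<not> sat M (s(y := w)) (E(X := A)) \<psi>)" for w
      using nv[OF ExN(3), of s "row K (ExN y \<psi>) s" "row K \<psi> (s(y := w))" \<zero>]
      unfolding viol_def fm.case using IH[of "s(y := w)"] by blast
    show ?case
      unfolding sat.simps using * zero_or_succ[of ?v] by (metis succ_ne_zero)
  qed simp_all
  then show ?thesis using assms(4) by blast
qed

text \<open>For a given \<open>A\<close>, correctness of an entry is arithmetical in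
  \<open>A\<close>, so correct values can be chosen uniformly for all rows at once.\<close>

lemma truth_table_exists:
  assumes "basic \<theta>" "fm_vars \<theta> \<subseteq> {..<K}" and E: "range E \<subseteq> sets M" and A: "A \<in> sets M"
  obtains F where "fn F" "\<And>\<phi> s. \<phi> \<in> subfms \<theta> \<Longrightarrow> good (E(X := A)) \<phi> s (app M F (row K \<phi> s))"
    "\<And>m. app M F (pairN M \<zero> m) = \<zero> \<longleftrightarrow> m \<notin> A"
proof -
  let ?E = "E(X := A)"
  have E': "range ?E \<subseteq> sets M" using E A by auto
  let ?G = "\<lambda>i v. (\<forall>\<phi>\<in>subfms \<theta>. \<forall>s. i = row K \<phi> s \<longrightarrow> good ?E \<phi> s v) \<and>
    (\<forall>m. i = pairN M \<zero> m \<longrightarrow> (v = \<zero> \<longleftrightarrow> \<not> m \<in> A))"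
  have "bdef (\<lambda>e. ?G (e 0) (e 1))"
    by (intro bdef_conj bdef_fin_all finite_subfms bdef_all_env bdef_imp bdef_good[OF _ E'] bdef_all
        bdef_iff bdef_not bdef_mem A bdef_eq tdef_row tdef_pair tdef_var tdef_const
        basic_subfms[OF _ assms(1)])
  moreover have "\<exists>v. ?G i v" for i
  proof (cases "\<exists>\<phi>\<in>subfms \<theta>. \<exists>s. i = row K \<phi> s")
    case True
    then obtain \<phi> s where \<phi>: "\<phi> \<in> subfms \<theta>" "i = row K \<phi> s" by blast
    obtain v where v: "good ?E \<phi> s v" using good_ex by blast
    \<comment> \<open>A row remembers only the code of the assignment, so one value must serve all
      assignments with this code; they agree on the variables of the formula.\<close>
    have "good ?E \<phi> s' v" if "enc K s = enc K s'" for s'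
    proof -
      have "s n = s' n" if "n \<in> fm_vars \<phi>" for n
        using that fm_vars_subfms[OF \<phi>(1)] assms(2) \<open>enc K s = enc K s'\<close> unfolding enc_eq_iff by blast
      then show ?thesis using good_cong[of \<phi> s s'] v by blast
    qed
    then show ?thesis unfolding \<phi>(2) row_eq_iff by (intro exI[of _ v]) auto
  next
    case False
    show ?thesis
    proof (cases "\<exists>m\<in>A. i = pairN M \<zero> m")
      case True
      then show ?thesis using False by (intro exI[of _ \<one>]) auto
    next
      case False': False
      then show ?thesis using False by (intro exI[of _ \<zero>]) auto
    qed
  qed
  ultimately obtain F where F: "fn F" "\<And>i. ?G i (app M F i)"
    by (rule uniformization[of ?G]) (rule that)
  show thesis
  proof (rule that[OF F(1)])
    show "good ?E \<phi> s (app M F (row K \<phi> s))" if "\<phi> \<in> subfms \<theta>" for \<phi> s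
      using F(2)[of "row K \<phi> s"] that by blast
    show "app M F (pairN M \<zero> m) = \<zero> \<longleftrightarrow> m \<notin> A" for m
      using F(2)[of "pairN M \<zero> m"] by blast
  qed
qed

text \<open>Entries of \<open>F\<close> are determined by their rows, so the values compared by a
  clause are correct ones, and correct values satisfy every clause.\<close>

lemma truth_table_no_viol:
  assumes F: "fn F" and good: "\<And>\<phi> s. \<phi> \<in> subfms \<theta> \<Longrightarrow> good (E(X := A)) \<phi> s (app M F (row K \<phi> s))"
    and A: "\<And>m. app M F (pairN M \<zero> m) = \<zero> \<longleftrightarrow> m \<notin> A"
    and \<phi>: "\<phi> \<in> subfms \<theta>" and pqr: "p \<in> F" "q \<in> F" "r \<in> F"
  shows "\<not> viol K X E \<phi> s p q r"
proof
  assume viol: "viol K X E \<phi> s p q r"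
  have app: "v = app M F i" if "pairN M i v \<in> F" for i v
    using app_eq_iff[OF F UNIV_I] that by metis
  have val: "v = \<zero> \<longleftrightarrow> \<not> sat M s (E(X := A)) \<psi>" if "pairN M (row K \<psi> s) v \<in> F" "\<psi> \<in> subfms \<theta>" for \<psi> s v
    using good[OF that(2), of s, unfolded good_def, THEN conjunct1] app[OF that(1)] by (simp only:)
  have valA: "v = \<zero> \<longleftrightarrow> m \<notin> A" if "pairN M (pairN M \<zero> m) v \<in> F" for m v
    using A[of m] app[OF that] by (simp only:)
  have sub: "\<psi> \<in> subfms \<theta>" if "\<psi> \<in> subfms \<phi>" for \<psi>
    using subfms_mono[OF \<phi>] that by blast
  show False
  proof (cases \<phi>)
    case (Eq t t')
    then obtain v where "p = pairN M (row K \<phi> s) v" "(v = \<zero>) = (eval M s t = eval M s t')"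
      using viol unfolding viol_def by auto
    then show False using val[OF _ \<phi>, of s v] pqr(1) unfolding Eq sat.simps by blast
  next
    case (Less t t')
    then obtain v where "p = pairN M (row K \<phi> s) v" "(v = \<zero>) = (eval M s t \<prec> eval M s t')"
      using viol unfolding viol_def by auto
    then show False using val[OF _ \<phi>, of s v] pqr(1) unfolding Less sat.simps by blast
  next
    case (Mem t Y)
    show False
    proof (cases "Y = X")
      case True
      then obtain v u where "p = pairN M (row K \<phi> s) v" "q = pairN M (pairN M \<zero> (eval M s t)) u"
        "(v = \<zero>) \<noteq> (u = \<zero>)" using viol unfolding viol_def Mem by auto
      then show False
        using val[OF _ \<phi>, of s v] valA[of "eval M s t" u] pqr True
        unfolding Mem sat.simps True fun_upd_same by blast
    next
      case False
      then obtain v where "p = pairN M (row K \<phi> s) v" "(v = \<zero>) = (eval M s t \<in> E Y)"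
        using viol unfolding viol_def Mem by auto
      then show False
        using val[OF _ \<phi>, of s v] pqr(1)
        unfolding Mem sat.simps fun_upd_other[OF False] by blast
    qed
  next
    case (Neg \<psi>)
    then have "\<psi> \<in> subfms \<theta>" by (intro sub) (simp add: subfms_refl)
    moreover obtain v u where "p = pairN M (row K \<phi> s) v" "q = pairN M (row K \<psi> s) u" "(v = \<zero>) = (u = \<zero>)"
      using viol unfolding viol_def Neg by auto
    ultimately show False
      using val[OF _ \<phi>, of s v] val[of \<psi> s u] pqr unfolding Neg sat.simps by blast
  next
    case (Conj \<psi> \<chi>)
    then have "\<psi> \<in> subfms \<theta>" "\<chi> \<in> subfms \<theta>" by (auto intro!: sub simp: subfms_refl)
    moreover obtain v u u' where "p = pairN M (row K \<phi> s) v" "q = pairN M (row K \<psi> s) u"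
      "r = pairN M (row K \<chi> s) u'" "(v = \<zero>) = (u \<noteq> \<zero> \<and> u' \<noteq> \<zero>)"
      using viol unfolding viol_def Conj by auto
    ultimately show False
      using val[OF _ \<phi>, of s v] val[of \<psi> s u] val[of \<chi> s u'] pqr unfolding Conj sat.simps by blast
  next
    case (ExN y \<psi>)
    then have \<psi>: "\<psi> \<in> subfms \<theta>" by (intro sub) (simp add: subfms_refl)
    from viol obtain v w u where p: "p = pairN M (row K \<phi> s) v" and q: "q = pairN M (row K \<psi> (s(y := w))) u"
      and vu: "v = \<zero> \<and> u \<noteq> \<zero> \<or> v = w \<oplus> \<one> \<and> u = \<zero>"
      unfolding viol_def ExN fm.case by blast
    have u: "u = \<zero> \<longleftrightarrow> \<not> sat M (s(y := w)) (E(X := A)) \<psi>" using val \<psi> pqr(2) q by blast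
    have "v = \<zero> \<longleftrightarrow> \<not> sat M s (E(X := A)) \<phi>" using val \<phi> pqr(1) p by blast
    moreover have "v = w \<oplus> \<one> \<longrightarrow> sat M (s(y := w)) (E(X := A)) \<psi>"
    proof -
      have v: "v = app M F (row K \<phi> s)" using app pqr(1) unfolding p .
      show ?thesis unfolding v using good[OF \<phi>, of s] unfolding good_def ExN fm.case by blast
    qed
    ultimately show False using vu u unfolding ExN sat.simps by blast
  qed (use viol in \<open>simp_all add: viol_def\<close>)
qed

text \<open>The complement is treated: a set that refutes the formula exists iff some table without
  violations marks the formula false.\<close>

lemma pi11_comprehension:
  assumes "arithmetical \<theta>" "range E \<subseteq> sets M"
  shows "{a. \<forall>A\<in>sets M. sat M (e(x := a)) (E(X := A)) \<theta>} \<in> sets M"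
proof -
  let ?\<theta> = "to_basic \<theta>"
  have basic: "basic ?\<theta>" using assms(1) by (rule basic_to_basic)
  obtain K where K: "fm_vars ?\<theta> \<subseteq> {..<K}"
    using finite_fm_vars[of ?\<theta>] unfolding finite_nat_set_iff_bounded by blast
  \<comment> \<open>The first disjunct forbids a table that makes the formula true at
    \<open>a\<close>. It alone depends on \<open>a\<close>, because one table covers all
    assignments.\<close>
  let ?B = "\<lambda>a p q r. (\<exists>v. p = pairN M (row K ?\<theta> (e(x := a))) v \<and> v \<noteq> \<zero>) \<or>
    (\<exists>\<phi>\<in>subfms ?\<theta>. \<exists>s. viol K X E \<phi> s p q r)"
  have "bdef (\<lambda>e. ?B (e 0) (e 1) (e 2) (e 3))"
    by (intro bdef_disj bdef_ex bdef_conj bdef_eq bdef_not bdef_fin_ex finite_subfms bdef_ex_env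
        bdef_viol assms(2) tdef_pair tdef_row tdef_upd tdef_var tdef_const)
  from tree_comprehension[OF this]
  have S: "{a. \<exists>F. fn F \<and> (\<forall>p\<in>F. \<forall>q\<in>F. \<forall>r\<in>F. \<not> ?B a p q r)} \<in> sets M" (is "?S \<in> _") .
  have "a \<in> ?S \<longleftrightarrow> (\<exists>A\<in>sets M. \<not> sat M (e(x := a)) (E(X := A)) ?\<theta>)" for a
  proof
    assume "a \<in> ?S"
    then obtain F where F: "fn F" and nB: "\<forall>p\<in>F. \<forall>q\<in>F. \<forall>r\<in>F. \<not> ?B a p q r" by blast
    let ?A = "{m. app M F (pairN M \<zero> m) \<noteq> \<zero>}"
    have "?A \<in> sets M" by (intro bdef_comprehension bdef_not bdef_app F tdef_pair tdef_var tdef_const)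
    moreover have "app M F (row K ?\<theta> (e(x := a))) = \<zero> \<longleftrightarrow> \<not> sat M (e(x := a)) (E(X := ?A)) ?\<theta>"
      by (rule truth_table_sound[OF F refl _ basic]) (use nB in blast)
    moreover have "app M F (row K ?\<theta> (e(x := a))) = \<zero>"
    proof -
      have "pairN M (row K ?\<theta> (e(x := a))) (app M F (row K ?\<theta> (e(x := a)))) \<in> F"
        using app_eq_iff[OF F UNIV_I] by metis
      then show ?thesis using nB by blast
    qed
    ultimately show "\<exists>A\<in>sets M. \<not> sat M (e(x := a)) (E(X := A)) ?\<theta>" by blast
  next
    assume "\<exists>A\<in>sets M. \<not> sat M (e(x := a)) (E(X := A)) ?\<theta>"
    then obtain A where A: "A \<in> sets M" "\<not> sat M (e(x := a)) (E(X := A)) ?\<theta>" by blast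
    obtain F where F: "fn F" "\<And>\<phi> s. \<phi> \<in> subfms ?\<theta> \<Longrightarrow> good (E(X := A)) \<phi> s (app M F (row K \<phi> s))"
      "\<And>m. app M F (pairN M \<zero> m) = \<zero> \<longleftrightarrow> m \<notin> A"
      using basic K assms(2) A(1) by (rule truth_table_exists[of ?\<theta> K E A X]) (rule that)
    have "app M F (row K ?\<theta> (e(x := a))) = \<zero>"
      using F(2)[OF subfms_refl, of "e(x := a)"] A(2) unfolding good_def by blast
    then have "v = \<zero>" if "pairN M (row K ?\<theta> (e(x := a))) v \<in> F" for v
      using app_eq_iff[OF F(1) UNIV_I] that by metis
    moreover have "\<not> viol K X E \<phi> s p q r" if "\<phi> \<in> subfms ?\<theta>" "p \<in> F" "q \<in> F" "r \<in> F" for \<phi> s p q r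
      using F that by (rule truth_table_no_viol)
    ultimately have "\<forall>p\<in>F. \<forall>q\<in>F. \<forall>r\<in>F. \<not> ?B a p q r" by blast
    then show "a \<in> ?S" using F(1) by blast
  qed
  then have "{a. \<forall>A\<in>sets M. sat M (e(x := a)) (E(X := A)) \<theta>} = {a. \<not> a \<in> ?S}"
    by (simp only: sat_to_basic) blast
  moreover have "{a. \<not> a \<in> ?S} \<in> sets M"
    by (intro bdef_comprehension bdef_not bdef_mem[OF _ S] tdef_var)
  ultimately show ?thesis by (simp only:)
qed

end

theorem theorem3p9:
  fixes M :: "'a L2_structure"
  assumes "RCA0 M"
    and "restricted_valuation_extension_CTL M"
  shows "Pi11_CA0 M"
proof -
  interpret rca0_ctl M by unfold_locales (rule assms)+
  have "\<exists>Y\<in>sets M. \<forall>a. a \<in> Y \<longleftrightarrow> sat M (e(x := a)) E \<phi>"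
    if "\<phi> \<in> Pi11" "range E \<subseteq> sets M" for \<phi> x e E
  proof -
    from that(1) obtain X \<theta> where \<phi>: "\<phi> = AllS X \<theta>" "arithmetical \<theta>" unfolding Pi11_def by blast
    from pi11_comprehension[OF \<phi>(2) that(2), of e x X] show ?thesis
      unfolding \<phi>(1) sat.simps by (rule bexI[rotated]) simp
  qed
  then show ?thesis
    unfolding Pi11_CA0_def comprehension_scheme_def by (intro conjI assms(1) ballI allI impI)
qed

end
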